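(* Let $\mathcal N\subseteq\mathcal X^2$ be a symmetric neighbor relation, $Q$ a probability measure on $\mathcal Z$, and $P_{Z|X}$ a Markov kernel with $P_{Z|X}(\cdot|x)\ll Q$ for all $x$. If $P_{Z|X}$ is $(\varepsilon,\delta)$-DP with respect to $\mathcal N$, then for every $\alpha>1$ the PPR-compressed mechanism $x\mapsto((Z_i)_{i\ge1},K)$ is $(2\alpha\varepsilon,\,2\delta)$-DP with respect to $\mathcal N$.
   Context: A Markov kernel $P_{W|X}$ is $(\varepsilon,\delta)$-DP w.r.t. a symmetric relation $\mathcal N\subseteq\mathcal X^2$ if $\Pr(W\in S\mid X=x)\le e^{\varepsilon}\Pr(W\in S\mid X=x')+\delta$ for all $(x,x')\in\mathcal N$ and measurable $S$; $\varepsilon$-DP means $(\varepsilon,0)$-DP. PPR: let $Z_1,Z_2,\ldots$ be i.i.d. $\sim Q$, independent of the points $T_1\le T_2\le\cdots$ of a rate-$1$ Poisson process on $[0,\infty)$. For input $x$, with $P=P_{Z|X}(\cdot|x)$, set $\tilde T_i:=T_i(\frac{\mathrm dP}{\mathrm dQ}(Z_i))^{-1}$ ($:=\infty$ if the derivative is $0$, $\infty^{-\alpha}:=0$), and draw $K$ with $\Pr(K=k\mid (Z_i,T_i)_i)=\tilde T_k^{-\alpha}/\sum_i\tilde T_i^{-\alpha}$ (fresh randomness for each input). The PPR-compressed mechanism is the kernel $x\mapsto((Z_i)_{i\ge1},K)$; the shared sequence $(Z_i)$ does not depend on $x$.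
   Formalization: The formal theorem adds the standard assumption ε ≥ 0; for ε < 0 the claim as written fails (e.g. P = Q, ε = −0.1, δ = 1 − e^{−0.1}, α = 2). *)

theory Defs
  imports "HOL-Probability.Probability"
begin

definition dp_kernel :: "('x \<times> 'x) set \<Rightarrow> ('x \<Rightarrow> 'w measure) \<Rightarrow> real \<Rightarrow> real \<Rightarrow> bool" where
  "dp_kernel N M \<epsilon> \<delta> \<longleftrightarrow>
     (\<forall>(x, x') \<in> N. \<forall>S \<in> sets (M x). measure (M x) S \<le> exp \<epsilon> * measure (M x') S + \<delta>)"

text \<open>Inter-arrival times of a rate-1 Poisson process: i.i.d. Exp(1).\<close>
definition exp1 :: "real measure" where
  "exp1 = density lborel (exponential_density 1)"

text \<open>Points of the Poisson process from the gaps: index i (0-based) is T_{i+1}.\<close>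
definition ppr_T :: "(nat \<Rightarrow> real) \<Rightarrow> nat \<Rightarrow> real" where
  "ppr_T e i = (\<Sum>j\<le>i. e j)"

text \<open>Weight  (T~_k)^(-alpha)  with T~_k = T_k / (dP/dQ)(Z_k); T~_k = infinity (weight 0) if the derivative is 0.\<close>
definition ppr_weight :: "'z measure \<Rightarrow> 'z measure \<Rightarrow> real \<Rightarrow> (nat \<Rightarrow> 'z) \<Rightarrow> (nat \<Rightarrow> real) \<Rightarrow> nat \<Rightarrow> real" where
  "ppr_weight Q P \<alpha> z e k =
     (let f = enn2real (RN_deriv Q P (z k)) in
      if f = 0 then 0 else (ppr_T e k / f) powr (- \<alpha>))"

definition ppr_prob :: "'z measure \<Rightarrow> 'z measure \<Rightarrow> real \<Rightarrow> (nat \<Rightarrow> 'z) \<Rightarrow> (nat \<Rightarrow> real) \<Rightarrow> nat \<Rightarrow> real" where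
  "ppr_prob Q P \<alpha> z e k = ppr_weight Q P \<alpha> z e k / (\<Sum>i. ppr_weight Q P \<alpha> z e i)"

text \<open>Output law of the PPR-compressed mechanism ((Z_i)_i, K) for target distribution P:
  joint law of (Z, gaps, K) as a density w.r.t. Q^N x Exp(1)^N x counting measure, then projected.\<close>
definition ppr_mech :: "'z measure \<Rightarrow> 'z measure \<Rightarrow> real \<Rightarrow> ((nat \<Rightarrow> 'z) \<times> nat) measure" where
  "ppr_mech Q P \<alpha> =
     distr (density (PiM UNIV (\<lambda>_::nat. Q) \<Otimes>\<^sub>M PiM UNIV (\<lambda>_::nat. exp1) \<Otimes>\<^sub>M count_space UNIV)
                    (\<lambda>(z, e, k). ennreal (ppr_prob Q P \<alpha> z e k)))
           (PiM UNIV (\<lambda>_::nat. Q) \<Otimes>\<^sub>M count_space UNIV)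
           (\<lambda>(z, e, k). (z, k))"

end

theory Submission
  imports Defs
begin

text \<open>
  Let \<open>f\<^sub>1, f\<^sub>2\<close> be the densities of two neighbouring inputs, \<open>m = min f\<^sub>1 (e\<^sup>\<epsilon> f\<^sub>2)\<close> and
  \<open>g = max f\<^sub>1 (e\<^sup>-\<^sup>\<epsilon> f\<^sub>2)\<close>. The quantity
  \<open>q\<^sub>k = 1 / (1 + (T\<^sub>k / m(Z\<^sub>k))\<^sup>\<alpha> \<Sum>\<^sub>i\<^sub>\<noteq>\<^sub>k (g(Z\<^sub>i) / T\<^sub>i)\<^sup>\<alpha>)\<close> is at most the selection probability
  of \<open>k\<close> under \<open>f\<^sub>1\<close>, and at most \<open>exp (2 \<alpha> \<epsilon>)\<close> times the one under \<open>f\<^sub>2\<close>. So it suffices that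
  \<open>\<Sum>\<^sub>k q\<^sub>k\<close> has expectation at least \<open>1 - 2 \<delta>\<close>. By Mecke's formula for the marked Poisson process and
  the substitution \<open>t = m(z) u\<close>, this expectation is \<open>(\<integral> m dQ) \<Psi>\<close> where \<open>\<Psi>\<close> depends on \<open>g\<close> only;
  the case \<open>m = g\<close>, in which the \<open>q\<^sub>k\<close> sum to 1, shows \<open>\<Psi> = 1 / \<integral> g dQ\<close>. Finally differential
  privacy gives \<open>\<integral> m dQ \<ge> 1 - \<delta>\<close> and \<open>\<integral> g dQ \<le> 1 + \<delta>\<close>. Mecke's formula with a truncated weight also
  shows that the total weight is almost surely finite, which is where \<open>\<alpha> > 1\<close> enters.
\<close>

section \<open>Sequences with one entry removed\<close>

definition skip :: "nat \<Rightarrow> nat \<Rightarrow> nat" where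
  "skip k i = (if i < k then i else Suc i)"

lemma case_nat_skip_0: "case_nat a z (skip 0 i) = z i"
  by (simp add: skip_def)

lemma case_nat_skip_Suc: "case_nat a z (skip (Suc k) i) = case_nat a (\<lambda>i. z (skip k i)) i"
  by (auto simp: skip_def split: nat.split)

lemma measurable_skip [measurable (raw)]:
  assumes [measurable]: "f \<in> measurable N (PiM UNIV (\<lambda>_::nat. M))"
  shows "(\<lambda>x i. f x (skip k i)) \<in> measurable N (PiM UNIV (\<lambda>_::nat. M))"
  by (rule measurable_abs_UNIV) measurable

text \<open>Induction on \<open>k\<close> with entry 0 split off. It later separates the own weight
  of a point from that of its competitors.\<close>

lemma suminf_skip:
  fixes f :: "nat \<Rightarrow> ennreal"
  shows "(\<Sum>i. f i) = f k + (\<Sum>i. f (skip k i))"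
proof (induction k arbitrary: f)
  case 0
  have "(\<Sum>i. f i) = (\<Sum>i. f (i + 1)) + (\<Sum>i<1. f i)"
    by (intro suminf_offset summableI)
  then show ?case
    by (simp add: skip_def add.commute)
next
  case (Suc k)
  have "(\<Sum>i. f i) = (\<Sum>i. f (Suc i)) + f 0"
    using suminf_offset[OF summableI, of f 1] by simp
  also have "(\<Sum>i. f (Suc i)) = f (Suc k) + (\<Sum>i. f (Suc (skip k i)))"
    by (rule Suc)
  finally have "(\<Sum>i. f i) = f (Suc k) + ((\<Sum>i. f (Suc (skip k i))) + f 0)"
    by (simp add: add.assoc)
  also have "(\<Sum>i. f (Suc (skip k i))) + f 0 = (\<Sum>i. f (skip (Suc k) i))"
  proof -
    have "skip (Suc k) (Suc i) = Suc (skip k i)" "skip (Suc k) 0 = 0" for i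
      by (auto simp: skip_def)
    then show ?thesis
      using suminf_offset[OF summableI, of "\<lambda>i. f (skip (Suc k) i)" 1] by simp
  qed
  finally show ?case .
qed

text \<open>Prepending an independent draw to an i.i.d. sequence does not change its law
  (\<open>PiM_iter\<close>). The inductions on integrals below peel off entry 0 in this way.\<close>

lemma nn_integral_PiM_iter:
  assumes "prob_space M" and F: "F \<in> borel_measurable (PiM UNIV (\<lambda>_::nat. M))"
  shows "(\<integral>\<^sup>+z. F z \<partial>PiM UNIV (\<lambda>_::nat. M)) =
    (\<integral>\<^sup>+x. \<integral>\<^sup>+z. F (case_nat x z) \<partial>PiM UNIV (\<lambda>_::nat. M) \<partial>M)"
proof -
  interpret prob_space M by fact
  interpret sequence_space M ..
  note F[measurable]
  have "(\<integral>\<^sup>+z. F z \<partial>S) = (\<integral>\<^sup>+z. F z \<partial>distr (M \<Otimes>\<^sub>M S) S (\<lambda>(s, \<omega>). case_nat s \<omega>))"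
    by (simp add: PiM_iter)
  also have "\<dots> = (\<integral>\<^sup>+p. F (case p of (s, \<omega>) \<Rightarrow> case_nat s \<omega>) \<partial>(M \<Otimes>\<^sub>M S))"
    by (rule nn_integral_distr) measurable
  also have "\<dots> = (\<integral>\<^sup>+x. \<integral>\<^sup>+z. F (case_nat x z) \<partial>S \<partial>M)"
    by (subst P.nn_integral_fst[symmetric]) simp_all
  finally show ?thesis .
qed

text \<open>Induction on \<open>k\<close>: peel off entry 0, remove entry \<open>k\<close> of the
  tail by the induction hypothesis, exchange the two independent draws and put entry 0 back. The
  removed entry is thus independent of the rest, which is again i.i.d.\<close>

lemma nn_integral_PiM_remove:
  assumes "prob_space M" and "F \<in> borel_measurable (M \<Otimes>\<^sub>M PiM UNIV (\<lambda>_::nat. M))"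
  shows "(\<integral>\<^sup>+z. F (z k, \<lambda>i. z (skip k i)) \<partial>PiM UNIV (\<lambda>_::nat. M)) =
    (\<integral>\<^sup>+x. \<integral>\<^sup>+z. F (x, z) \<partial>PiM UNIV (\<lambda>_::nat. M) \<partial>M)"
  using assms(2)
proof (induction k arbitrary: F)
  case 0
  note [measurable] = this
  show ?case
    by (subst nn_integral_PiM_iter) (simp_all add: assms case_nat_skip_0)
next
  case (Suc k)
  note [measurable] = Suc.prems
  interpret prob_space M by fact
  interpret sequence_space M ..
  interpret MM: pair_sigma_finite M M ..
  have "(\<integral>\<^sup>+z. F (z (Suc k), \<lambda>i. z (skip (Suc k) i)) \<partial>S) =
    (\<integral>\<^sup>+x. \<integral>\<^sup>+z. F (z k, case_nat x (\<lambda>i. z (skip k i))) \<partial>S \<partial>M)"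
    by (subst nn_integral_PiM_iter) (simp_all add: assms case_nat_skip_Suc)
  also have "\<dots> = (\<integral>\<^sup>+x. \<integral>\<^sup>+y. \<integral>\<^sup>+z. F (y, case_nat x z) \<partial>S \<partial>M \<partial>M)"
  proof (rule nn_integral_cong)
    fix x assume [measurable]: "x \<in> space M"
    show "(\<integral>\<^sup>+z. F (z k, case_nat x (\<lambda>i. z (skip k i))) \<partial>S) =
       (\<integral>\<^sup>+y. \<integral>\<^sup>+z. F (y, case_nat x z) \<partial>S \<partial>M)"
      using Suc.IH[of "\<lambda>(y, z). F (y, case_nat x z)"] by simp
  qed
  also have "\<dots> = (\<integral>\<^sup>+y. \<integral>\<^sup>+x. \<integral>\<^sup>+z. F (y, case_nat x z) \<partial>S \<partial>M \<partial>M)"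
    by (rule MM.Fubini') measurable
  also have "\<dots> = (\<integral>\<^sup>+y. \<integral>\<^sup>+z. F (y, z) \<partial>S \<partial>M)"
    by (intro nn_integral_cong nn_integral_PiM_iter[symmetric]) (simp_all add: assms)
  finally show ?case .
qed

section \<open>Mecke's formula for the marked Poisson process\<close>

lemma prob_space_exp1: "prob_space exp1"
  unfolding exp1_def by (rule prob_space_exponential_density) simp

lemma sets_exp1 [measurable_cong]: "sets exp1 = sets borel"
  by (simp add: exp1_def)

text \<open>Excluding the null point 0 leads to left-open intervals, the form in which the gaps tile
  the half-line later on.\<close>

lemma nn_integral_exp1:
  assumes [measurable]: "f \<in> borel_measurable borel"
  shows "(\<integral>\<^sup>+x. f x \<partial>exp1) = (\<integral>\<^sup>+x. ennreal (exp (- x)) * indicator {0<..} x * f x \<partial>lborel)"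
proof -
  have "(\<integral>\<^sup>+x. f x \<partial>exp1) = (\<integral>\<^sup>+x. ennreal (exponential_density 1 x) * f x \<partial>lborel)"
    unfolding exp1_def by (subst nn_integral_density) (simp_all add: exponential_density_def)
  also have "\<dots> = (\<integral>\<^sup>+x. ennreal (exp (- x)) * indicator {0<..} x * f x \<partial>lborel)"
    using AE_lborel_singleton[of "0::real"]
    by (intro nn_integral_cong_AE) (auto simp: exponential_density_def split: split_indicator)
  finally show ?thesis .
qed

lemma borel_measurable_indicator_Ioc [measurable (raw)]:
  fixes f g h :: "'a \<Rightarrow> real"
  assumes [measurable]: "f \<in> borel_measurable M" "g \<in> borel_measurable M" "h \<in> borel_measurable M"
  shows "(\<lambda>x. indicator {f x<..g x} (h x) :: ennreal) \<in> borel_measurable M"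
  unfolding indicator_def greaterThanAtMost_iff by measurable

text \<open>In the coordinates \<open>t = s + a\<close> and \<open>c = a + b\<close> the joint
  density \<open>exp (- a) * exp (- b)\<close> becomes \<open>exp (- c)\<close> and no longer
  involves \<open>a\<close>. What remains is one exponential gap \<open>c\<close> and a Lebesgue
  point \<open>t\<close> inside it.\<close>

lemma nn_integral_exp1_shear:
  assumes [measurable]: "case_prod F \<in> borel_measurable (borel \<Otimes>\<^sub>M borel)"
  shows "(\<integral>\<^sup>+a. \<integral>\<^sup>+b. F (s + a) (s + a + b) \<partial>exp1 \<partial>exp1) =
    (\<integral>\<^sup>+t. \<integral>\<^sup>+c. F t (s + c) * indicator {s<..s + c} t \<partial>exp1 \<partial>lborel)"
proof -
  interpret prob_space exp1 by (rule prob_space_exp1)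
  have inner: "ennreal (exp (- a)) * indicator {0<..} a * (\<integral>\<^sup>+b. F (s + a) (s + a + b) \<partial>exp1) =
    (\<integral>\<^sup>+c. F (s + a) (s + c) * indicator {s<..s + c} (s + a) \<partial>exp1)" for a
  proof -
    have exp_add': "ennreal (exp (- (a + b))) = ennreal (exp (- a)) * ennreal (exp (- b))"
      "ennreal (exp (- (b + a))) = ennreal (exp (- a)) * ennreal (exp (- b))" for b
      by (simp_all add: ennreal_mult[symmetric] exp_add[symmetric])
    have "ennreal (exp (- a)) * indicator {0<..} a * (\<integral>\<^sup>+b. F (s + a) (s + a + b) \<partial>exp1) =
      (\<integral>\<^sup>+b. ennreal (exp (- (a + b))) * indicator {0<..} a * indicator {a<..} (a + b)
          * F (s + a) (s + (a + b)) \<partial>lborel)"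
      by (subst nn_integral_exp1, simp, subst nn_integral_cmult[symmetric], simp)
        (auto intro!: nn_integral_cong simp: exp_add' ac_simps simp del: minus_add_distrib
          split: split_indicator)
    also have "\<dots> = (\<integral>\<^sup>+c. ennreal (exp (- c)) * indicator {0<..} a * indicator {a<..} c
          * F (s + a) (s + c) \<partial>lborel)"
      by (subst (2) nn_integral_real_affine[where t = a and c = 1]) simp_all
    \<comment> \<open>The point \<open>c = a\<close> is null, so the right endpoint may be
      closed.\<close>
    also have "\<dots> = (\<integral>\<^sup>+c. F (s + a) (s + c) * indicator {s<..s + c} (s + a) \<partial>exp1)"
      using AE_lborel_singleton[of a]
      by (subst nn_integral_exp1)
        (auto intro!: nn_integral_cong_AE simp: mult.commute split: split_indicator)
    finally show ?thesis .
  qed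
  have "(\<integral>\<^sup>+a. \<integral>\<^sup>+b. F (s + a) (s + a + b) \<partial>exp1 \<partial>exp1) =
    (\<integral>\<^sup>+a. \<integral>\<^sup>+c. F (s + a) (s + c) * indicator {s<..s + c} (s + a) \<partial>exp1 \<partial>lborel)"
    by (subst nn_integral_exp1) (simp_all add: inner)
  also have "\<dots> = (\<integral>\<^sup>+t. \<integral>\<^sup>+c. F t (s + c) * indicator {s<..s + c} t \<partial>exp1 \<partial>lborel)"
    by (subst (2) nn_integral_real_affine[where t = s and c = 1]) simp_all
  finally show ?thesis .
qed

lemma measurable_arrival_times [measurable]:
  "(\<lambda>e. ppr_T e i) \<in> borel_measurable (PiM UNIV (\<lambda>_::nat. exp1))"
  unfolding ppr_T_def by measurable

lemma measurable_arrival_seq [measurable (raw)]: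
  assumes [measurable]: "f \<in> measurable N (PiM UNIV (\<lambda>_::nat. exp1))"
    "s \<in> borel_measurable N"
  shows "(\<lambda>x i. s x + ppr_T (f x) (r i)) \<in> measurable N (PiM UNIV (\<lambda>_::nat. borel))"
  by (rule measurable_abs_UNIV) measurable

lemma measurable_arrival_seq' [measurable (raw)]:
  assumes [measurable]: "f \<in> measurable N (PiM UNIV (\<lambda>_::nat. exp1))"
  shows "(\<lambda>x i. ppr_T (f x) (r i)) \<in> measurable N (PiM UNIV (\<lambda>_::nat. borel))"
    and "(\<lambda>x. ppr_T (f x)) \<in> measurable N (PiM UNIV (\<lambda>_::nat. borel))"
  by (rule measurable_abs_UNIV, measurable)+

lemma arrival_case_nat:
  "ppr_T (case_nat a e) 0 = a" "ppr_T (case_nat a e) (Suc i) = a + ppr_T e i"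
  by (simp_all add: ppr_T_def sum.atMost_Suc_shift del: sum.atMost_Suc)

lemma gap_sum_case_nat: "(\<Sum>j<Suc k. case_nat a e j) = a + (\<Sum>j<k. e j)" for a :: real
  by (simp add: sum.lessThan_Suc_shift del: sum.lessThan_Suc)

text \<open>A point \<open>t\<close> falling between the \<open>k\<close>-th and the \<open>(k+1)\<close>-st arrival splits one
  exponential gap into two independent ones.\<close>

lemma nn_integral_arrival_remove:
  assumes "G \<in> borel_measurable (borel \<Otimes>\<^sub>M PiM UNIV (\<lambda>_::nat. borel))"
  shows "(\<integral>\<^sup>+e. G (s + ppr_T e k, \<lambda>i. s + ppr_T e (skip k i)) \<partial>PiM UNIV (\<lambda>_::nat. exp1)) =
    (\<integral>\<^sup>+t. \<integral>\<^sup>+e. G (t, \<lambda>i. s + ppr_T e i) * indicator {s + (\<Sum>j<k. e j)<..s + ppr_T e k} t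
      \<partial>PiM UNIV (\<lambda>_::nat. exp1) \<partial>lborel)"
  using assms
proof (induction k arbitrary: s G)
  case 0
  note [measurable] = this
  interpret prob_space exp1 by (rule prob_space_exp1)
  interpret sequence_space exp1 ..
  \<comment> \<open>\<open>F t c\<close> integrates out all gaps beyond the first two, given that
    the removed point is \<open>t\<close> and the next arrival is \<open>c\<close>.\<close>
  define F where "F t c = (\<integral>\<^sup>+e. G (t, case_nat c (\<lambda>i. c + ppr_T e i)) \<partial>S)" for t c
  have [measurable]: "case_prod F \<in> borel_measurable (borel \<Otimes>\<^sub>M borel)"
    unfolding F_def by measurable
  have shift: "(\<lambda>i. s + ppr_T (case_nat c e) i) = case_nat (s + c) (\<lambda>i. s + c + ppr_T e i)" for s c e
    by (auto simp: arrival_case_nat split: nat.split)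
  have "(\<integral>\<^sup>+e. G (s + ppr_T e 0, \<lambda>i. s + ppr_T e (skip 0 i)) \<partial>S) =
    (\<integral>\<^sup>+a. \<integral>\<^sup>+e. G (s + a, \<lambda>i. s + a + ppr_T e i) \<partial>S \<partial>exp1)"
    by (subst nn_integral_PiM_iter[OF prob_space_exp1])
      (simp_all add: arrival_case_nat skip_def add.assoc)
  also have "\<dots> = (\<integral>\<^sup>+a. \<integral>\<^sup>+b. F (s + a) (s + a + b) \<partial>exp1 \<partial>exp1)"
    unfolding F_def
    by (intro nn_integral_cong, subst nn_integral_PiM_iter[OF prob_space_exp1])
      (simp_all add: shift)
  also have "\<dots> = (\<integral>\<^sup>+t. \<integral>\<^sup>+c. F t (s + c) * indicator {s<..s + c} t \<partial>exp1 \<partial>lborel)"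
    by (rule nn_integral_exp1_shear) measurable
  also have "\<dots> = (\<integral>\<^sup>+t. \<integral>\<^sup>+e. G (t, \<lambda>i. s + ppr_T e i)
      * indicator {s + (\<Sum>j<0. e j)<..s + ppr_T e 0} t \<partial>S \<partial>lborel)"
    unfolding F_def
    by (intro nn_integral_cong, subst (2) nn_integral_PiM_iter[OF prob_space_exp1])
      (simp_all add: shift arrival_case_nat nn_integral_multc[symmetric])
  finally show ?case .
next
  case (Suc k)
  note [measurable] = Suc.prems
  interpret prob_space exp1 by (rule prob_space_exp1)
  interpret sequence_space exp1 ..
  interpret LE: pair_sigma_finite lborel exp1 ..
  have shift: "(\<lambda>i. s + ppr_T (case_nat c e) i) = case_nat (s + c) (\<lambda>i. s + c + ppr_T e i)" for c e
    by (auto simp: arrival_case_nat split: nat.split)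
  have shift_skip: "(\<lambda>i. s + ppr_T (case_nat c e) (skip (Suc k) i)) =
      case_nat (s + c) (\<lambda>i. s + c + ppr_T e (skip k i))" for c e
    by (auto simp: arrival_case_nat skip_def split: nat.split)
  have "(\<integral>\<^sup>+e. G (s + ppr_T e (Suc k), \<lambda>i. s + ppr_T e (skip (Suc k) i)) \<partial>S) =
    (\<integral>\<^sup>+a. \<integral>\<^sup>+e. G (s + a + ppr_T e k, case_nat (s + a) (\<lambda>i. s + a + ppr_T e (skip k i))) \<partial>S \<partial>exp1)"
    by (subst nn_integral_PiM_iter[OF prob_space_exp1])
      (simp_all add: arrival_case_nat shift_skip add.assoc)
  \<comment> \<open>The first gap only moves the origin from \<open>s\<close> to
    \<open>s + a\<close>, which is why the induction runs over an arbitrary start.\<close>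
  also have "\<dots> = (\<integral>\<^sup>+a. \<integral>\<^sup>+t. \<integral>\<^sup>+e. G (t, case_nat (s + a) (\<lambda>i. s + a + ppr_T e i))
      * indicator {s + a + (\<Sum>j<k. e j)<..s + a + ppr_T e k} t \<partial>S \<partial>lborel \<partial>exp1)"
  proof (rule nn_integral_cong)
    fix a
    show "(\<integral>\<^sup>+e. G (s + a + ppr_T e k, case_nat (s + a) (\<lambda>i. s + a + ppr_T e (skip k i))) \<partial>S) =
      (\<integral>\<^sup>+t. \<integral>\<^sup>+e. G (t, case_nat (s + a) (\<lambda>i. s + a + ppr_T e i))
      * indicator {s + a + (\<Sum>j<k. e j)<..s + a + ppr_T e k} t \<partial>S \<partial>lborel)"
      using Suc.IH[of "\<lambda>(t, x). G (t, case_nat (s + a) x)" "s + a"] by simp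
  qed
  also have "\<dots> = (\<integral>\<^sup>+t. \<integral>\<^sup>+a. \<integral>\<^sup>+e. G (t, case_nat (s + a) (\<lambda>i. s + a + ppr_T e i))
      * indicator {s + a + (\<Sum>j<k. e j)<..s + a + ppr_T e k} t \<partial>S \<partial>exp1 \<partial>lborel)"
    by (rule LE.Fubini') measurable
  also have "\<dots> = (\<integral>\<^sup>+t. \<integral>\<^sup>+e. G (t, \<lambda>i. s + ppr_T e i)
      * indicator {s + (\<Sum>j<Suc k. e j)<..s + ppr_T e (Suc k)} t \<partial>S \<partial>lborel)"
    by (intro nn_integral_cong, subst (2) nn_integral_PiM_iter[OF prob_space_exp1])
      (simp_all add: shift arrival_case_nat gap_sum_case_nat add.assoc del: sum.lessThan_Suc)
  finally show ?case .
qed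

section \<open>Almost sure behaviour of the arrival times\<close>

text \<open>The first \<open>Suc n\<close> entries all lie in \<open>A\<close> with probability
  \<open>measure M A ^ Suc n\<close>, which tends to 0. This serves twice: for unbounded gaps and
  for hitting a set of positive mass.\<close>

lemma AE_PiM_ex_notin:
  assumes "prob_space M" and A: "A \<in> sets M" and less: "measure M A < 1"
  shows "AE z in PiM UNIV (\<lambda>_::nat. M). \<exists>i. z i \<notin> A"
proof -
  interpret prob_space M by fact
  interpret sequence_space M ..
  have "(\<lambda>n. measure M A ^ Suc n) \<longlonglongrightarrow> measure S (Pi UNIV (\<lambda>_. A))"
    using measure_PiM_countable[of "\<lambda>_. A"] A by simp
  moreover have "(\<lambda>n. measure M A ^ Suc n) \<longlonglongrightarrow> 0"
    using less by (intro LIMSEQ_Suc LIMSEQ_power_zero) simp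
  ultimately have "measure S (Pi UNIV (\<lambda>_. A)) = 0"
    using LIMSEQ_unique by blast
  moreover have "Pi UNIV (\<lambda>_. A) \<in> sets S"
    using A by auto
  ultimately have "Pi UNIV (\<lambda>_. A) \<in> null_sets S"
    by (auto simp: null_sets_def P.emeasure_eq_measure)
  then show ?thesis
    by (rule AE_I') auto
qed

lemma measure_exp1_atMost_less_1: "measure exp1 {..a} < 1"
proof -
  interpret prob_space exp1 by (rule prob_space_exp1)
  have [simp]: "space exp1 = UNIV"
    by (simp add: exp1_def)
  have "measure exp1 {..a} \<noteq> 1"
  proof
    assume "measure exp1 {..a} = 1"
    then have "AE x in exp1. x \<in> {..a}"
      by (intro prob_eq_1[THEN iffD1]) auto
    then have "AE x in lborel. 0 < ennreal (exponential_density 1 x) \<longrightarrow> x \<le> a"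
      unfolding exp1_def by (subst (asm) AE_density) simp_all
    \<comment> \<open>The density is positive on this interval of length 1, so it cannot be
      null.\<close>
    then have "AE x in lborel. x \<notin> {max 0 a<..max 0 a + 1}"
      by eventually_elim (auto simp: exponential_density_def)
    then have "{max 0 a<..max 0 a + 1} \<in> null_sets lborel"
      using AE_iff_null_sets[of "{max 0 a<..max 0 a + 1}" lborel] by simp
    then show False
      by (simp add: null_sets_def)
  qed
  then show ?thesis
    using prob_le_1[of "{..a}"] by (rule le_neq_trans[rotated])
qed

text \<open>The almost sure event on which all pointwise arguments take place: the arrivals are
  positive, strictly increasing and unbounded.\<close>

definition arrivals_ok :: "(nat \<Rightarrow> real) \<Rightarrow> bool" where
  "arrivals_ok e \<longleftrightarrow> (\<forall>i. 0 < e i) \<and> (\<forall>t. \<exists>i. t < ppr_T e i)"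

text \<open>For every \<open>n\<close> some gap exceeds \<open>n\<close> almost surely, and with
  positive gaps an arrival time dominates its last gap. Hence the arrivals are unbounded.\<close>

lemma AE_arrivals_ok: "AE e in PiM UNIV (\<lambda>_::nat. exp1). arrivals_ok e"
proof -
  interpret prob_space exp1 by (rule prob_space_exp1)
  have "AE x in exp1. 0 < x"
    unfolding exp1_def using AE_lborel_singleton[of "0::real"]
    by (subst AE_density) (auto simp: exponential_density_def elim!: eventually_mono)
  then have "AE e in PiM UNIV (\<lambda>_::nat. exp1). \<forall>i. 0 < e i"
    unfolding AE_all_countable by (intro allI AE_PiM_component prob_space_exp1) auto
  moreover have "AE e in PiM UNIV (\<lambda>_::nat. exp1). \<forall>n::nat. \<exists>i. e i \<notin> {..real n}"
    unfolding AE_all_countable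
    by (intro allI AE_PiM_ex_notin prob_space_exp1 measure_exp1_atMost_less_1) measurable
  ultimately show ?thesis
  proof eventually_elim
    case (elim e)
    have "\<exists>i. t < ppr_T e i" for t
    proof -
      obtain n :: nat where "t < real n"
        using reals_Archimedean2 by blast
      moreover obtain i where "real n < e i"
        using elim(2) by (meson atMost_iff not_le)
      moreover have "e i \<le> ppr_T e i"
        unfolding ppr_T_def using elim(1) by (intro member_le_sum) (auto intro: less_imp_le)
      ultimately show ?thesis
        by (intro exI[of _ i]) linarith
    qed
    with elim show ?case
      by (simp add: arrivals_ok_def)
  qed
qed

lemma arrivals_ok_pos: "arrivals_ok e \<Longrightarrow> 0 < ppr_T e i"
  unfolding ppr_T_def arrivals_ok_def by (intro sum_pos) auto

text \<open>Half-open gaps between consecutive arrivals are disjoint, and they exhaust the positive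
  half-line because the arrivals are unbounded.\<close>

lemma suminf_indicator_gaps:
  assumes "arrivals_ok e"
  shows "(\<Sum>k. indicator {(\<Sum>j<k. e j)<..ppr_T e k} t :: ennreal) = indicator {0<..} t"
proof -
  \<comment> \<open>\<open>U\<close> includes the origin as \<open>U 0 = 0\<close>; since
    \<open>ppr_T\<close> counts from 0, gap \<open>k\<close> runs from \<open>U k\<close> to
    \<open>U (Suc k)\<close>.\<close>
  define U where "U k = (\<Sum>j<k. e j)" for k
  have T: "ppr_T e k = U (Suc k)" for k
    by (simp add: U_def ppr_T_def lessThan_Suc_atMost)
  have mono: "U i \<le> U j" if "i \<le> j" for i j
    using assms that unfolding U_def arrivals_ok_def
    by (intro sum_mono2) (auto intro: less_imp_le)
  have disj: "disjoint_family (\<lambda>k. {U k<..U (Suc k)})"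
  proof -
    have "{U m<..U (Suc m)} \<inter> {U n<..U (Suc n)} = {}" if "m < n" for m n
      using mono[of "Suc m" n] that by auto
    then show ?thesis
      unfolding disjoint_family_on_def by (metis inf_commute linorder_neqE_nat)
  qed
  have "(\<Union>k. {U k<..U (Suc k)}) = {0<..}"
  proof (intro equalityI subsetI)
    fix x assume "x \<in> (\<Union>k. {U k<..U (Suc k)})"
    then show "x \<in> {0<..}"
    proof (elim UN_E)
      fix k assume "x \<in> {U k<..U (Suc k)}"
      moreover have "U 0 \<le> U k" by (rule mono) simp
      ultimately show ?thesis by (simp add: U_def)
    qed
  next
    fix x :: real assume "x \<in> {0<..}"
    then have x: "0 < x" by simp
    \<comment> \<open>The first arrival not before \<open>x\<close> is the right end of the gap
      containing \<open>x\<close>.\<close>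
    define n where "n = (LEAST n. x \<le> U n)"
    have "\<exists>n. x \<le> U n"
      using assms unfolding arrivals_ok_def T by (meson less_imp_le)
    then have n: "x \<le> U n"
      unfolding n_def by (rule LeastI_ex)
    with x have "n \<noteq> 0"
      by (auto simp: U_def intro!: Nat.gr0I)
    then obtain k where k: "n = Suc k"
      using not0_implies_Suc by blast
    then have "\<not> x \<le> U k"
      using not_less_Least[of k "\<lambda>n. x \<le> U n"] unfolding n_def by simp
    with n k show "x \<in> (\<Union>k. {U k<..U (Suc k)})"
      by (intro UN_I[of k]) auto
  qed
  then show ?thesis
    unfolding T U_def[symmetric] by (simp add: suminf_indicator[OF disj])
qed

section \<open>Mecke's formula from the removal of marks and arrivals\<close>

text \<open>For fixed \<open>k\<close>, removing mark \<open>k\<close> leaves an i.i.d. sequence,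
  and removing arrival \<open>k\<close> leaves a Poisson sequence with a Lebesgue point
  \<open>t\<close> confined to gap \<open>k\<close>. Summed over \<open>k\<close> the gaps tile the
  half-line, and the confinement reduces to \<open>0 < t\<close>.\<close>

lemma mecke_arrivals:
  assumes Q: "prob_space Q"
    and meas: "\<Phi> \<in> borel_measurable
      (Q \<Otimes>\<^sub>M borel \<Otimes>\<^sub>M PiM UNIV (\<lambda>_::nat. Q) \<Otimes>\<^sub>M PiM UNIV (\<lambda>_::nat. borel))"
  shows "(\<integral>\<^sup>+z. \<integral>\<^sup>+e. (\<Sum>k. \<Phi> (z k, ppr_T e k, \<lambda>i. z (skip k i), \<lambda>i. ppr_T e (skip k i)))
      \<partial>PiM UNIV (\<lambda>_::nat. exp1) \<partial>PiM UNIV (\<lambda>_::nat. Q)) =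
    (\<integral>\<^sup>+x. \<integral>\<^sup>+t. indicator {0<..} t * (\<integral>\<^sup>+z. \<integral>\<^sup>+e. \<Phi> (x, t, z, ppr_T e)
      \<partial>PiM UNIV (\<lambda>_::nat. exp1) \<partial>PiM UNIV (\<lambda>_::nat. Q)) \<partial>lborel \<partial>Q)"
proof -
  interpret E: prob_space exp1 by (rule prob_space_exp1)
  interpret E: sequence_space exp1 ..
  interpret Q: prob_space Q by fact
  interpret Q: sequence_space Q ..
  interpret LQ: pair_sigma_finite lborel Q.S ..
  note meas[measurable]
  have "(\<integral>\<^sup>+z. \<integral>\<^sup>+e. (\<Sum>k. \<Phi> (z k, ppr_T e k, \<lambda>i. z (skip k i), \<lambda>i. ppr_T e (skip k i))) \<partial>E.S \<partial>Q.S) =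
    (\<Sum>k. \<integral>\<^sup>+z. \<integral>\<^sup>+e. \<Phi> (z k, ppr_T e k, \<lambda>i. z (skip k i), \<lambda>i. ppr_T e (skip k i)) \<partial>E.S \<partial>Q.S)"
  proof -
    have "(\<integral>\<^sup>+e. (\<Sum>k. \<Phi> (z k, ppr_T e k, \<lambda>i. z (skip k i), \<lambda>i. ppr_T e (skip k i))) \<partial>E.S) =
        (\<Sum>k. \<integral>\<^sup>+e. \<Phi> (z k, ppr_T e k, \<lambda>i. z (skip k i), \<lambda>i. ppr_T e (skip k i)) \<partial>E.S)"
      if "z \<in> space Q.S" for z
    proof -
      have [measurable]: "z k \<in> space Q" "(\<lambda>i. z (skip k i)) \<in> space Q.S" for k
        using that by (auto simp: space_PiM PiE_iff)
      show ?thesis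
        by (intro nn_integral_suminf) measurable
    qed
    then show ?thesis
      by (subst nn_integral_suminf[symmetric], measurable) (intro nn_integral_cong, simp)
  qed
  also have "\<dots> = (\<Sum>k. \<integral>\<^sup>+x. \<integral>\<^sup>+z. \<integral>\<^sup>+e. \<Phi> (x, ppr_T e k, z, \<lambda>i. ppr_T e (skip k i)) \<partial>E.S \<partial>Q.S \<partial>Q)"
  proof (rule suminf_cong)
    fix k
    have "(\<lambda>(x, z). \<integral>\<^sup>+e. \<Phi> (x, ppr_T e k, z, \<lambda>i. ppr_T e (skip k i)) \<partial>E.S)
        \<in> borel_measurable (Q \<Otimes>\<^sub>M Q.S)"
      by measurable
    from nn_integral_PiM_remove[OF Q this, of k]
    show "(\<integral>\<^sup>+z. \<integral>\<^sup>+e. \<Phi> (z k, ppr_T e k, \<lambda>i. z (skip k i), \<lambda>i. ppr_T e (skip k i)) \<partial>E.S \<partial>Q.S) =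
      (\<integral>\<^sup>+x. \<integral>\<^sup>+z. \<integral>\<^sup>+e. \<Phi> (x, ppr_T e k, z, \<lambda>i. ppr_T e (skip k i)) \<partial>E.S \<partial>Q.S \<partial>Q)"
      by simp
  qed
  also have "\<dots> = (\<Sum>k. \<integral>\<^sup>+x. \<integral>\<^sup>+z. \<integral>\<^sup>+t. \<integral>\<^sup>+e. \<Phi> (x, t, z, ppr_T e)
      * indicator {(\<Sum>j<k. e j)<..ppr_T e k} t \<partial>E.S \<partial>lborel \<partial>Q.S \<partial>Q)"
  proof (intro suminf_cong nn_integral_cong)
    fix k x z
    assume [measurable]: "x \<in> space Q" "z \<in> space Q.S"
    show "(\<integral>\<^sup>+e. \<Phi> (x, ppr_T e k, z, \<lambda>i. ppr_T e (skip k i)) \<partial>E.S) =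
      (\<integral>\<^sup>+t. \<integral>\<^sup>+e. \<Phi> (x, t, z, ppr_T e) * indicator {(\<Sum>j<k. e j)<..ppr_T e k} t \<partial>E.S \<partial>lborel)"
      using nn_integral_arrival_remove[of "\<lambda>(t, y). \<Phi> (x, t, z, y)" 0 k] by simp
  qed
  also have "\<dots> = (\<integral>\<^sup>+x. \<integral>\<^sup>+z. \<integral>\<^sup>+t. \<integral>\<^sup>+e. (\<Sum>k. \<Phi> (x, t, z, ppr_T e)
      * indicator {(\<Sum>j<k. e j)<..ppr_T e k} t) \<partial>E.S \<partial>lborel \<partial>Q.S \<partial>Q)"
  proof -
    \<comment> \<open>Naming the inner integral as a jointly measurable function lets the sum over
      \<open>k\<close> pass through the three outer integrals one by one.\<close>
    define H where "H k = (\<lambda>(x, z, t). \<integral>\<^sup>+e. \<Phi> (x, t, z, ppr_T e)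
      * indicator {(\<Sum>j<k. e j)<..ppr_T e k} t \<partial>E.S)" for k
    have [measurable]: "H k \<in> borel_measurable (Q \<Otimes>\<^sub>M Q.S \<Otimes>\<^sub>M lborel)" for k
      unfolding H_def by measurable
    have "(\<Sum>k. \<integral>\<^sup>+e. \<Phi> (x, t, z, ppr_T e) * indicator {(\<Sum>j<k. e j)<..ppr_T e k} t \<partial>E.S) =
        (\<integral>\<^sup>+e. (\<Sum>k. \<Phi> (x, t, z, ppr_T e) * indicator {(\<Sum>j<k. e j)<..ppr_T e k} t) \<partial>E.S)"
      if [measurable]: "x \<in> space Q" "z \<in> space Q.S" for x z t
      by (intro nn_integral_suminf[symmetric]) measurable
    then have "(\<integral>\<^sup>+x. \<integral>\<^sup>+z. \<integral>\<^sup>+t. \<integral>\<^sup>+e. (\<Sum>k. \<Phi> (x, t, z, ppr_T e)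
      * indicator {(\<Sum>j<k. e j)<..ppr_T e k} t) \<partial>E.S \<partial>lborel \<partial>Q.S \<partial>Q) =
      (\<integral>\<^sup>+x. \<integral>\<^sup>+z. \<integral>\<^sup>+t. (\<Sum>k. H k (x, z, t)) \<partial>lborel \<partial>Q.S \<partial>Q)"
      unfolding H_def by (intro nn_integral_cong) simp
    also have "\<dots> = (\<integral>\<^sup>+x. \<integral>\<^sup>+z. (\<Sum>k. \<integral>\<^sup>+t. H k (x, z, t) \<partial>lborel) \<partial>Q.S \<partial>Q)"
      by (intro nn_integral_cong nn_integral_suminf) measurable
    also have "\<dots> = (\<integral>\<^sup>+x. (\<Sum>k. \<integral>\<^sup>+z. \<integral>\<^sup>+t. H k (x, z, t) \<partial>lborel \<partial>Q.S) \<partial>Q)"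
      by (intro nn_integral_cong nn_integral_suminf) measurable
    also have "\<dots> = (\<Sum>k. \<integral>\<^sup>+x. \<integral>\<^sup>+z. \<integral>\<^sup>+t. H k (x, z, t) \<partial>lborel \<partial>Q.S \<partial>Q)"
      by (intro nn_integral_suminf) measurable
    finally show ?thesis
      by (simp add: H_def)
  qed
  \<comment> \<open>Exactly one gap contains a given \<open>t > 0\<close>.\<close>
  also have "\<dots> = (\<integral>\<^sup>+x. \<integral>\<^sup>+z. \<integral>\<^sup>+t. \<integral>\<^sup>+e. indicator {0<..} t * \<Phi> (x, t, z, ppr_T e) \<partial>E.S \<partial>lborel \<partial>Q.S \<partial>Q)"
  proof (rule nn_integral_cong, rule nn_integral_cong, rule nn_integral_cong, rule nn_integral_cong_AE)
    fix x z t
    show "AE e in E.S. (\<Sum>k. \<Phi> (x, t, z, ppr_T e) * indicator {(\<Sum>j<k. e j)<..ppr_T e k} t) =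
        indicator {0<..} t * \<Phi> (x, t, z, ppr_T e)"
      using AE_arrivals_ok
      by eventually_elim (simp add: suminf_indicator_gaps mult.commute)
  qed
  also have "\<dots> = (\<integral>\<^sup>+x. \<integral>\<^sup>+t. \<integral>\<^sup>+z. \<integral>\<^sup>+e. indicator {0<..} t * \<Phi> (x, t, z, ppr_T e) \<partial>E.S \<partial>Q.S \<partial>lborel \<partial>Q)"
  proof (rule nn_integral_cong)
    fix x assume [measurable]: "x \<in> space Q"
    show "(\<integral>\<^sup>+z. \<integral>\<^sup>+t. \<integral>\<^sup>+e. indicator {0<..} t * \<Phi> (x, t, z, ppr_T e) \<partial>E.S \<partial>lborel \<partial>Q.S) =
        (\<integral>\<^sup>+t. \<integral>\<^sup>+z. \<integral>\<^sup>+e. indicator {0<..} t * \<Phi> (x, t, z, ppr_T e) \<partial>E.S \<partial>Q.S \<partial>lborel)"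
      by (rule LQ.Fubini') measurable
  qed
  also have "\<dots> = (\<integral>\<^sup>+x. \<integral>\<^sup>+t. indicator {0<..} t * (\<integral>\<^sup>+z. \<integral>\<^sup>+e. \<Phi> (x, t, z, ppr_T e) \<partial>E.S \<partial>Q.S) \<partial>lborel \<partial>Q)"
  proof (intro nn_integral_cong)
    fix x t
    show "(\<integral>\<^sup>+z. \<integral>\<^sup>+e. indicator {0<..} t * \<Phi> (x, t, z, ppr_T e) \<partial>E.S \<partial>Q.S) =
        indicator {0<..} t * (\<integral>\<^sup>+z. \<integral>\<^sup>+e. \<Phi> (x, t, z, ppr_T e) \<partial>E.S \<partial>Q.S)"
      by (cases "0 < t") simp_all
  qed
  finally show ?thesis .
qed

section \<open>Selection probabilities\<close>

text \<open>As \<open>0 powr \<alpha> = 0\<close>, a vanishing density gets weight 0, in agreement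
  with the convention in \<open>ppr_weight\<close>. Extended nonnegative values make every total
  weight meaningful.\<close>

definition race_weight :: "real \<Rightarrow> real \<Rightarrow> real \<Rightarrow> ennreal" where
  "race_weight \<alpha> x t = ennreal ((x / t) powr \<alpha>)"

definition race_total :: "real \<Rightarrow> ('z \<Rightarrow> real) \<Rightarrow> (nat \<Rightarrow> 'z) \<Rightarrow> (nat \<Rightarrow> real) \<Rightarrow> ennreal" where
  "race_total \<alpha> g z \<tau> = (\<Sum>i. race_weight \<alpha> (g (z i)) (\<tau> i))"

text \<open>Own weight over own weight plus \<open>W\<close>, with the own weight divided out: the
  value depends on \<open>t\<close> and \<open>x\<close> through \<open>t / x\<close> only, which
  permits rescaling. The case \<open>x \<le> 0\<close> is separate because \<open>t / 0 = 0\<close>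
  would turn density 0 into probability 1.\<close>

definition race_prob :: "real \<Rightarrow> real \<Rightarrow> real \<Rightarrow> ennreal \<Rightarrow> ennreal" where
  "race_prob \<alpha> x t W = (if x \<le> 0 then 0 else inverse (1 + ennreal ((t / x) powr \<alpha>) * W))"

text \<open>For \<open>m = g = dP/dQ\<close> this is the selection probability of index \<open>k\<close>. The point \<open>k\<close> itself
  contributes the summand 1 of the denominator and only its competitors are weighted by \<open>g\<close>:
  bounding \<open>m\<close>-weight over total \<open>g\<close>-weight instead would lose a factor \<open>\<alpha>\<close> in \<open>\<delta>\<close>.\<close>

definition race_sel ::
    "real \<Rightarrow> ('z \<Rightarrow> real) \<Rightarrow> ('z \<Rightarrow> real) \<Rightarrow> (nat \<Rightarrow> 'z) \<Rightarrow> (nat \<Rightarrow> real) \<Rightarrow> nat \<Rightarrow> ennreal" where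
  "race_sel \<alpha> m g z e k = race_prob \<alpha> (m (z k)) (ppr_T e k)
     (race_total \<alpha> g (\<lambda>i. z (skip k i)) (\<lambda>i. ppr_T e (skip k i)))"

text \<open>The substitution \<open>t = c * u\<close>; it extracts the density of a mark as a linear
  factor after Mecke's formula.\<close>

lemma nn_integral_scale:
  fixes \<phi> :: "real \<Rightarrow> ennreal"
  assumes [measurable]: "\<phi> \<in> borel_measurable borel"
  shows "(\<integral>\<^sup>+t. indicator {0<..} t * (if c \<le> 0 then 0 else \<phi> (t / c)) \<partial>lborel) =
    ennreal c * (\<integral>\<^sup>+t. indicator {0<..} t * \<phi> t \<partial>lborel)"
proof (cases "c \<le> 0")
  case True
  then show ?thesis by (simp add: ennreal_neg)
next
  case False
  have "(\<integral>\<^sup>+t. indicator {0<..} t * \<phi> (t / c) \<partial>lborel) =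
    ennreal \<bar>c\<bar> * (\<integral>\<^sup>+t. indicator {0<..} (0 + c * t) * \<phi> ((0 + c * t) / c) \<partial>lborel)"
    using False by (intro nn_integral_real_affine) simp_all
  also have "(\<integral>\<^sup>+t. indicator {0<..} (0 + c * t) * \<phi> ((0 + c * t) / c) \<partial>lborel) =
      (\<integral>\<^sup>+t. indicator {0<..} t * \<phi> t \<partial>lborel)"
    using False by (intro nn_integral_cong) (auto simp: zero_less_mult_iff split: split_indicator)
  finally show ?thesis
    using False by simp
qed

text \<open>The truncation bounds the integrand by 1 up to \<open>t = 1\<close>; beyond,
  \<open>t powr - \<alpha>\<close> is integrable because \<open>\<alpha> > 1\<close>.\<close>

lemma nn_integral_min_powr_finite:
  assumes "\<alpha> > 1"
  shows "(\<integral>\<^sup>+t. indicator {0<..} t * min 1 (ennreal ((1 / t) powr \<alpha>)) \<partial>lborel) < \<infinity>"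
proof -
  have "(\<integral>\<^sup>+t. indicator {0<..} t * min 1 (ennreal ((1 / t) powr \<alpha>)) \<partial>lborel) \<le>
     (\<integral>\<^sup>+t. indicator {0..1} t + ennreal (t powr - \<alpha>) * indicator {1..} t \<partial>lborel)"
    by (intro nn_integral_mono)
      (auto split: split_indicator simp: powr_minus_divide powr_divide min_le_iff_disj)
  also have "\<dots> = 1 + (\<integral>\<^sup>+t. ennreal (t powr - \<alpha>) * indicator {1..} t \<partial>lborel)"
    by (subst nn_integral_add) simp_all
  also have "(\<integral>\<^sup>+t. ennreal (t powr - \<alpha>) * indicator {1..} t \<partial>lborel) =
      ennreal (0 - (1 powr (1 - \<alpha>) / (1 - \<alpha>)))"
  proof (rule nn_integral_FTC_atLeast[where F = "\<lambda>x. x powr (1 - \<alpha>) / (1 - \<alpha>)" and f = "\<lambda>x. x powr - \<alpha>"])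
    fix x :: real assume "1 \<le> x"
    then show "((\<lambda>x. x powr (1 - \<alpha>) / (1 - \<alpha>)) has_real_derivative x powr - \<alpha>) (at x)"
      using assms by (auto intro!: derivative_eq_intros)
  next
    have "((\<lambda>x. x powr (1 - \<alpha>)) \<longlongrightarrow> 0) at_top"
      using assms by (intro tendsto_neg_powr filterlim_ident) simp
    then show "((\<lambda>x. x powr (1 - \<alpha>) / (1 - \<alpha>)) \<longlongrightarrow> 0) at_top"
      using tendsto_divide[OF _ tendsto_const, of _ 0 at_top "1 - \<alpha>"] assms by force
  qed simp_all
  finally show ?thesis
    by (rule le_less_trans) simp
qed

text \<open>The terms of the truncated series tend to 0, so from some index on the truncation is
  inactive.\<close>

lemma suminf_ennreal_min_1_finite:
  fixes a :: "nat \<Rightarrow> real"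
  assumes a: "\<And>i. 0 \<le> a i" and fin: "(\<Sum>i. min 1 (ennreal (a i))) \<noteq> \<infinity>"
  shows "(\<Sum>i. ennreal (a i)) \<noteq> \<infinity>"
proof -
  have "min 1 (ennreal (a i)) = ennreal (min 1 (a i))" for i
    by (simp add: min_def)
  with fin have summ: "summable (\<lambda>i. min 1 (a i))"
    using a by (intro summable_suminf_not_top) auto
  then have "(\<lambda>i. min 1 (a i)) \<longlonglongrightarrow> 0"
    by (rule summable_LIMSEQ_zero)
  then have "eventually (\<lambda>i. min 1 (a i) < 1) sequentially"
    by (rule order_tendstoD) simp
  then have "eventually (\<lambda>i. min 1 (a i) = a i) sequentially"
    by eventually_elim (auto simp: min_def split: if_splits)
  then have "summable a"
    using summ summable_cong[of "\<lambda>i. min 1 (a i)" a] by simp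
  then show ?thesis
    unfolding infinity_ennreal_def using a by (rule ennreal_suminf_neq_top)
qed

lemma race_prob_eq_divide:
  assumes "0 \<le> x" "0 < t"
  shows "race_prob \<alpha> x t W = race_weight \<alpha> x t / (race_weight \<alpha> x t + W)"
proof (cases "x = 0")
  case True
  then show ?thesis by (simp add: race_prob_def race_weight_def)
next
  case False
  with assms have x: "0 < x" by simp
  define c where "c = (x / t) powr \<alpha>"
  have c: "0 < c" "(t / x) powr \<alpha> = inverse c"
    using x assms unfolding c_def by (simp_all add: powr_divide divide_simps)
  have "inverse (1 + ennreal (inverse c) * W) = ennreal c / (ennreal c + W)"
  proof (cases W rule: ennreal_cases)
    case (real r)
    have "1 + ennreal (inverse c) * W = ennreal (1 + inverse c * r)"
      using c real by (simp add: ennreal_mult)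
    also have "inverse \<dots> = ennreal (inverse (1 + inverse c * r))"
      using c real by (intro inverse_ennreal) (auto intro: add_pos_nonneg)
    also have "inverse (1 + inverse c * r) = c / (c + r)"
      using c real by (simp add: divide_simps)
    also have "ennreal (c / (c + r)) = ennreal c / (ennreal c + W)"
      using c real by (subst divide_ennreal[symmetric]) auto
    finally show ?thesis .
  next
    \<comment> \<open>Infinite competition makes both sides 0.\<close>
    case top
    then show ?thesis using c by (simp add: ennreal_mult_top)
  qed
  then show ?thesis
    using x c by (simp add: race_prob_def race_weight_def c_def)
qed

lemma race_total_split:
  "race_total \<alpha> g z \<tau> = race_weight \<alpha> (g (z k)) (\<tau> k)
     + race_total \<alpha> g (\<lambda>i. z (skip k i)) (\<lambda>i. \<tau> (skip k i))"
  unfolding race_total_def by (rule suminf_skip)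

lemma race_sel_eq_divide:
  assumes "0 \<le> g (z k)" "arrivals_ok e"
  shows "race_sel \<alpha> g g z e k = race_weight \<alpha> (g (z k)) (ppr_T e k) / race_total \<alpha> g z (ppr_T e)"
  unfolding race_sel_def using race_prob_eq_divide[OF assms(1) arrivals_ok_pos[OF assms(2)]]
    race_total_split[of \<alpha> g z "ppr_T e" k] by simp

lemma suminf_race_sel_le_1:
  assumes "\<And>k. 0 \<le> g (z k)" "arrivals_ok e"
  shows "(\<Sum>k. race_sel \<alpha> g g z e k) \<le> 1"
proof -
  \<comment> \<open>In \<open>ennreal\<close> the quotient is 0 if the total is 0 or infinite, so
    the bound covers the degenerate totals too.\<close>
  have "a / a \<le> 1" for a :: ennreal
    by (cases "a = 0 \<or> a = \<top>") (auto simp: less_top)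
  then show ?thesis
    by (simp add: race_sel_eq_divide assms race_total_def[symmetric])
qed

lemma suminf_race_sel_eq_1:
  assumes "\<And>k. 0 \<le> g (z k)" "arrivals_ok e"
    "race_total \<alpha> g z (ppr_T e) \<noteq> 0" "race_total \<alpha> g z (ppr_T e) \<noteq> \<infinity>"
  shows "(\<Sum>k. race_sel \<alpha> g g z e k) = 1"
  using assms(3,4)
  by (simp add: race_sel_eq_divide assms(1,2) race_total_def[symmetric] less_top)

lemma measurable_race_weight [measurable (raw)]:
  assumes [measurable]: "f \<in> borel_measurable N" "h \<in> borel_measurable N"
  shows "(\<lambda>x. race_weight \<alpha> (f x) (h x)) \<in> borel_measurable N"
  unfolding race_weight_def by measurable

lemma measurable_race_prob [measurable (raw)]:
  assumes [measurable]: "f \<in> borel_measurable N" "h \<in> borel_measurable N" "W \<in> borel_measurable N"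
  shows "(\<lambda>x. race_prob \<alpha> (f x) (h x) (W x)) \<in> borel_measurable N"
  unfolding race_prob_def by measurable

lemma measurable_race_total [measurable (raw)]:
  assumes [measurable]: "g \<in> borel_measurable Q" "f \<in> measurable N (PiM UNIV (\<lambda>_::nat. Q))"
    "h \<in> measurable N (PiM UNIV (\<lambda>_::nat. borel))"
  shows "(\<lambda>x. race_total \<alpha> g (f x) (h x)) \<in> borel_measurable N"
  unfolding race_total_def by measurable

lemma measurable_race_sel [measurable (raw)]:
  assumes [measurable]: "m \<in> borel_measurable Q" "g \<in> borel_measurable Q"
    "f \<in> measurable N (PiM UNIV (\<lambda>_::nat. Q))" "h \<in> measurable N (PiM UNIV (\<lambda>_::nat. exp1))"
  shows "(\<lambda>x. race_sel \<alpha> m g (f x) (h x) k) \<in> borel_measurable N"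
  unfolding race_sel_def by measurable

section \<open>Finiteness and positivity of the total weight\<close>

text \<open>Weights are not integrable near \<open>t = 0\<close>, so the expectation is taken of the
  truncated ones. By Mecke's formula and scaling it is \<open>C\<close> times the integral of
  \<open>g\<close>, hence finite; almost surely the truncated sum converges, and then so does the
  full one.\<close>

lemma AE_race_total_finite:
  assumes Q: "prob_space Q" and \<alpha>: "\<alpha> > 1"
    and g: "g \<in> borel_measurable Q" "\<And>x. 0 \<le> g x" "(\<integral>\<^sup>+x. ennreal (g x) \<partial>Q) < \<infinity>"
  shows "AE z in PiM UNIV (\<lambda>_::nat. Q). AE e in PiM UNIV (\<lambda>_::nat. exp1).
    race_total \<alpha> g z (ppr_T e) \<noteq> \<infinity>"
proof -
  interpret E: prob_space exp1 by (rule prob_space_exp1)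
  interpret E: sequence_space exp1 ..
  interpret Q: prob_space Q by fact
  interpret Q: sequence_space Q ..
  note g(1)[measurable]
  define C where "C = (\<integral>\<^sup>+t. indicator {0<..} t * min 1 (ennreal ((1 / t) powr \<alpha>)) \<partial>lborel)"
  have "(\<integral>\<^sup>+z. \<integral>\<^sup>+e. (\<Sum>k. min 1 (race_weight \<alpha> (g (z k)) (ppr_T e k))) \<partial>E.S \<partial>Q.S) =
    (\<integral>\<^sup>+x. \<integral>\<^sup>+t. indicator {0<..} t * min 1 (race_weight \<alpha> (g x) t) \<partial>lborel \<partial>Q)"
    using mecke_arrivals[OF Q, of "\<lambda>(x, t, _). min 1 (race_weight \<alpha> (g x) t)"]
    by (simp add: E.P.emeasure_space_1 Q.P.emeasure_space_1)
  also have "\<dots> = (\<integral>\<^sup>+x. ennreal (g x) * C \<partial>Q)"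
  proof (rule nn_integral_cong)
    fix x
    have "(\<integral>\<^sup>+t. indicator {0<..} t * min 1 (race_weight \<alpha> (g x) t) \<partial>lborel) =
      (\<integral>\<^sup>+t. indicator {0<..} t * (if g x \<le> 0 then 0
          else min 1 (ennreal ((1 / (t / g x)) powr \<alpha>))) \<partial>lborel)"
      using g(2)[of x]
      by (intro nn_integral_cong) (auto simp: race_weight_def split: split_indicator)
    also have "\<dots> = ennreal (g x) * C"
      unfolding C_def by (rule nn_integral_scale) measurable
    finally show "(\<integral>\<^sup>+t. indicator {0<..} t * min 1 (race_weight \<alpha> (g x) t) \<partial>lborel) =
      ennreal (g x) * C" .
  qed
  also have "\<dots> = (\<integral>\<^sup>+x. ennreal (g x) \<partial>Q) * C"
    by (rule nn_integral_multc) measurable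
  also have "\<dots> < \<infinity>"
    using g(3) nn_integral_min_powr_finite[OF \<alpha>] unfolding C_def
    by (simp add: ennreal_mult_less_top)
  finally have "AE z in Q.S. (\<integral>\<^sup>+e. (\<Sum>k. min 1 (race_weight \<alpha> (g (z k)) (ppr_T e k))) \<partial>E.S) \<noteq> \<infinity>"
    by (intro nn_integral_PInf_AE) simp_all
  then show ?thesis
    using AE_space
  proof eventually_elim
    case (elim z)
    then have [measurable]: "z k \<in> space Q" for k
      by (auto simp: space_PiM PiE_iff)
    have "AE e in E.S. (\<Sum>k. min 1 (race_weight \<alpha> (g (z k)) (ppr_T e k))) \<noteq> \<infinity>"
      using elim(1) by (intro nn_integral_PInf_AE) simp_all
    then show ?case
      by eventually_elim
        (simp only: race_total_def race_weight_def, rule suminf_ennreal_min_1_finite, auto)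
  qed
qed

text \<open>The set where \<open>g\<close> vanishes has mass below 1, so almost surely some mark
  avoids it and contributes positive weight. The exceptional set concerns the marks alone, hence the
  quantifier over \<open>e\<close> inside.\<close>

lemma AE_race_total_pos:
  assumes Q: "prob_space Q"
    and g: "g \<in> borel_measurable Q" "\<And>x. 0 \<le> g x" "(\<integral>\<^sup>+x. ennreal (g x) \<partial>Q) \<noteq> 0"
  shows "AE z in PiM UNIV (\<lambda>_::nat. Q). \<forall>e. arrivals_ok e \<longrightarrow> race_total \<alpha> g z (ppr_T e) \<noteq> 0"
proof -
  interpret Q: prob_space Q by fact
  note g(1)[measurable]
  define A where "A = {x \<in> space Q. g x \<le> 0}"
  have [measurable]: "A \<in> sets Q"
    unfolding A_def by measurable
  have "measure Q A \<noteq> 1"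
  proof
    assume "measure Q A = 1"
    then have "AE x in Q. x \<in> A"
      by (intro Q.prob_eq_1[THEN iffD1]) auto
    then have "AE x in Q. ennreal (g x) = 0"
      by eventually_elim (simp add: A_def ennreal_neg)
    then have "(\<integral>\<^sup>+x. ennreal (g x) \<partial>Q) = 0"
      by (subst nn_integral_0_iff_AE) auto
    with g(3) show False by simp
  qed
  then have "measure Q A < 1"
    using Q.prob_le_1[of A] by (rule le_neq_trans[rotated])
  then have "AE z in PiM UNIV (\<lambda>_::nat. Q). \<exists>i. z i \<notin> A"
    by (intro AE_PiM_ex_notin Q) auto
  then show ?thesis
    using AE_space
  proof eventually_elim
    case (elim z)
    then obtain i where "0 < g (z i)"
      by (auto simp: A_def space_PiM PiE_iff not_le)
    then have "race_weight \<alpha> (g (z i)) (ppr_T e i) \<noteq> 0" if "arrivals_ok e" for e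
      using arrivals_ok_pos[OF that, of i] by (simp add: race_weight_def ennreal_eq_0_iff not_le)
    then show ?case
      unfolding race_total_split[of \<alpha> g z _ i] by auto
  qed
qed

section \<open>Expected sum of the selection probabilities\<close>

text \<open>In Mecke's formula the distinguished mark \<open>x\<close> enters only through
  \<open>t / m x\<close>; rescaling \<open>t\<close> releases the factor \<open>m x\<close> and
  leaves an integral in which only \<open>g\<close> occurs.\<close>

lemma nn_integral_suminf_race_sel:
  assumes Q: "prob_space Q" and [measurable]: "m \<in> borel_measurable Q" "g \<in> borel_measurable Q"
  shows "(\<integral>\<^sup>+z. \<integral>\<^sup>+e. (\<Sum>k. race_sel \<alpha> m g z e k)
      \<partial>PiM UNIV (\<lambda>_::nat. exp1) \<partial>PiM UNIV (\<lambda>_::nat. Q)) =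
    (\<integral>\<^sup>+x. ennreal (m x) \<partial>Q) * (\<integral>\<^sup>+t. indicator {0<..} t *
      (\<integral>\<^sup>+z. \<integral>\<^sup>+e. inverse (1 + ennreal (t powr \<alpha>) * race_total \<alpha> g z (ppr_T e))
        \<partial>PiM UNIV (\<lambda>_::nat. exp1) \<partial>PiM UNIV (\<lambda>_::nat. Q)) \<partial>lborel)"
    (is "_ = _ * ?\<Psi>")
proof -
  interpret E: prob_space exp1 by (rule prob_space_exp1)
  interpret E: sequence_space exp1 ..
  interpret Q: prob_space Q by fact
  interpret Q: sequence_space Q ..
  define \<psi> where "\<psi> t = (\<integral>\<^sup>+z. \<integral>\<^sup>+e. inverse (1 + ennreal (t powr \<alpha>) * race_total \<alpha> g z (ppr_T e)) \<partial>E.S \<partial>Q.S)" for t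
  have [measurable]: "\<psi> \<in> borel_measurable borel"
    unfolding \<psi>_def by measurable
  have "(\<integral>\<^sup>+z. \<integral>\<^sup>+e. (\<Sum>k. race_sel \<alpha> m g z e k) \<partial>E.S \<partial>Q.S) =
    (\<integral>\<^sup>+x. \<integral>\<^sup>+t. indicator {0<..} t *
      (\<integral>\<^sup>+z. \<integral>\<^sup>+e. race_prob \<alpha> (m x) t (race_total \<alpha> g z (ppr_T e)) \<partial>E.S \<partial>Q.S) \<partial>lborel \<partial>Q)"
    unfolding race_sel_def
    using mecke_arrivals[OF Q, of "\<lambda>(x, t, z, \<tau>). race_prob \<alpha> (m x) t (race_total \<alpha> g z \<tau>)"]
    by simp
  also have "\<dots> = (\<integral>\<^sup>+x. \<integral>\<^sup>+t. indicator {0<..} t * (if m x \<le> 0 then 0 else \<psi> (t / m x)) \<partial>lborel \<partial>Q)"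
    by (intro nn_integral_cong) (simp add: race_prob_def \<psi>_def)
  also have "\<dots> = (\<integral>\<^sup>+x. ennreal (m x) * ?\<Psi> \<partial>Q)"
    by (simp add: nn_integral_scale \<psi>_def[symmetric])
  also have "\<dots> = (\<integral>\<^sup>+x. ennreal (m x) \<partial>Q) * ?\<Psi>"
    by (rule nn_integral_multc) measurable
  finally show ?thesis .
qed

text \<open>The unknown common factor in the previous lemma is identified by taking \<open>m = g\<close>,
  where the selection probabilities sum to one.\<close>

lemma nn_integral_suminf_race_sel_eq:
  assumes Q: "prob_space Q" and \<alpha>: "\<alpha> > 1"
    and m: "m \<in> borel_measurable Q" and g: "g \<in> borel_measurable Q" "\<And>x. 0 \<le> g x"
    and pos: "(\<integral>\<^sup>+x. ennreal (g x) \<partial>Q) \<noteq> 0" and fin: "(\<integral>\<^sup>+x. ennreal (g x) \<partial>Q) < \<infinity>"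
  shows "(\<integral>\<^sup>+z. \<integral>\<^sup>+e. (\<Sum>k. race_sel \<alpha> m g z e k)
      \<partial>PiM UNIV (\<lambda>_::nat. exp1) \<partial>PiM UNIV (\<lambda>_::nat. Q)) * (\<integral>\<^sup>+x. ennreal (g x) \<partial>Q) =
    (\<integral>\<^sup>+x. ennreal (m x) \<partial>Q)"
proof -
  interpret E: prob_space exp1 by (rule prob_space_exp1)
  interpret E: sequence_space exp1 ..
  interpret Q: prob_space Q by fact
  interpret Q: sequence_space Q ..
  define \<Psi> where "\<Psi> = (\<integral>\<^sup>+t. indicator {0<..} t *
      (\<integral>\<^sup>+z. \<integral>\<^sup>+e. inverse (1 + ennreal (t powr \<alpha>) * race_total \<alpha> g z (ppr_T e)) \<partial>E.S \<partial>Q.S) \<partial>lborel)"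
  note \<Psi> = nn_integral_suminf_race_sel[OF Q _ g(1), of _ \<alpha>, folded \<Psi>_def]
  have "(\<integral>\<^sup>+z. \<integral>\<^sup>+e. (\<Sum>k. race_sel \<alpha> g g z e k) \<partial>E.S \<partial>Q.S) = (\<integral>\<^sup>+z. \<integral>\<^sup>+e. 1 \<partial>E.S \<partial>Q.S)"
  proof (rule nn_integral_cong_AE)
    show "AE z in Q.S. (\<integral>\<^sup>+e. (\<Sum>k. race_sel \<alpha> g g z e k) \<partial>E.S) = (\<integral>\<^sup>+e. 1 \<partial>E.S)"
      using AE_race_total_finite[OF Q \<alpha> g fin] AE_race_total_pos[OF Q g pos, of \<alpha>]
    proof eventually_elim
      case (elim z)
      show ?case
      proof (rule nn_integral_cong_AE)
        show "AE e in E.S. (\<Sum>k. race_sel \<alpha> g g z e k) = 1"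
          using elim(1) AE_arrivals_ok
          by eventually_elim (use elim(2) g(2) in \<open>auto intro!: suminf_race_sel_eq_1\<close>)
      qed
    qed
  qed
  then have "(\<integral>\<^sup>+x. ennreal (g x) \<partial>Q) * \<Psi> = 1"
    using \<Psi>[OF g(1)] by (simp add: E.P.emeasure_space_1 Q.P.emeasure_space_1)
  then show ?thesis
    unfolding \<Psi>[OF m] by (metis mult.assoc mult.commute mult.right_neutral)
qed

section \<open>Comparison of neighbouring inputs\<close>

lemma ennreal_inverse_antimono:
  fixes a b :: ennreal
  shows "a \<le> b \<Longrightarrow> inverse b \<le> inverse a"
  including ennreal.lifting by transfer (rule ereal_inverse_antimono)

lemma race_prob_mono:
  assumes "0 < t" "x \<le> y" "V \<le> W" "0 \<le> \<alpha>"
  shows "race_prob \<alpha> x t W \<le> race_prob \<alpha> y t V"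
proof (cases "x \<le> 0")
  case False
  then have "(t / y) powr \<alpha> \<le> (t / x) powr \<alpha>"
    using assms by (intro powr_mono2) (auto intro!: divide_left_mono)
  then have "1 + ennreal ((t / y) powr \<alpha>) * V \<le> 1 + ennreal ((t / x) powr \<alpha>) * W"
    using assms by (intro add_left_mono mult_mono ennreal_leI) auto
  then show ?thesis
    using False assms by (simp add: race_prob_def ennreal_inverse_antimono)
qed (simp add: race_prob_def)

text \<open>Weights are monotone and homogeneous of degree \<open>\<alpha>\<close> in the
  density.\<close>

lemma race_total_scaled_mono:
  assumes "\<And>i. 0 < \<tau> i" "\<And>x. 0 \<le> g x" "\<And>x. g x \<le> c * h x" "0 \<le> c" "0 \<le> \<alpha>"
  shows "race_total \<alpha> g z \<tau> \<le> ennreal (c powr \<alpha>) * race_total \<alpha> h z \<tau>"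
proof -
  have "race_weight \<alpha> (g (z i)) (\<tau> i) \<le> ennreal (c powr \<alpha>) * race_weight \<alpha> (h (z i)) (\<tau> i)" for i
  proof -
    have "(g (z i) / \<tau> i) powr \<alpha> \<le> (c * h (z i) / \<tau> i) powr \<alpha>"
      using assms(1)[of i] assms(2,3)[of "z i"] assms(5)
      by (intro powr_mono2) (auto intro!: divide_right_mono)
    also have "\<dots> = c powr \<alpha> * (h (z i) / \<tau> i) powr \<alpha>"
      using powr_mult[of c "h (z i) / \<tau> i" \<alpha>] by simp
    finally show ?thesis
      unfolding race_weight_def by (subst ennreal_mult[symmetric]) (auto intro: ennreal_leI)
  qed
  then have "(\<Sum>i. race_weight \<alpha> (g (z i)) (\<tau> i)) \<le> (\<Sum>i. ennreal (c powr \<alpha>) * race_weight \<alpha> (h (z i)) (\<tau> i))"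
    by (intro suminf_le summableI) auto
  then show ?thesis
    by (simp add: race_total_def)
qed

text \<open>A smaller own density and heavier competitors both lower the chance of being
  selected.\<close>

lemma race_sel_le_race_sel:
  assumes "arrivals_ok e" "0 \<le> \<alpha>" "\<And>x. 0 \<le> f x" "\<And>x. m x \<le> f x" "\<And>x. f x \<le> g x"
  shows "race_sel \<alpha> m g z e k \<le> race_sel \<alpha> f f z e k"
  unfolding race_sel_def
  using race_total_scaled_mono[of "\<lambda>i. ppr_T e (skip k i)" f 1 g \<alpha> "\<lambda>i. z (skip k i)"] assms
  by (intro race_prob_mono arrivals_ok_pos) (auto simp: arrivals_ok_pos)

text \<open>Since \<open>d \<ge> 1\<close>, \<open>1 + V / d\<close> is at least
  \<open>(1 + V) / d\<close>.\<close>

lemma inverse_scaled_le: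
  fixes V :: ennreal
  assumes "1 \<le> d"
  shows "inverse (1 + ennreal (inverse d) * V) \<le> ennreal d * inverse (1 + V)"
proof (cases V rule: ennreal_cases)
  case (real r)
  have eq: "inverse (1 + ennreal b) = ennreal (inverse (1 + b))" if "0 \<le> b" for b
    using that by (subst inverse_ennreal[symmetric]) auto
  have "inverse (1 + inverse d * r) \<le> d * inverse (1 + r)"
    using assms real by (simp add: divide_simps)
  then show ?thesis
    using assms real eq[of r] eq[of "inverse d * r"]
    by (simp add: ennreal_mult[symmetric] ennreal_leI)
qed (use assms in \<open>simp add: ennreal_mult_top\<close>)

text \<open>Raising the own density to at most \<open>c * f\<close> multiplies the own weight by at
  most \<open>c powr \<alpha>\<close>; competitors with \<open>g \<ge> f / c\<close> lose at most
  the same factor. The odds thus grow by at most \<open>c powr (2 * \<alpha>)\<close>, which is the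
  source of the factor 2 in the exponent.\<close>

lemma race_sel_le_scaled_race_sel:
  assumes e: "arrivals_ok e" and "0 \<le> \<alpha>" "1 \<le> c"
    and f: "\<And>x. 0 \<le> f x" "\<And>x. m x \<le> c * f x" "\<And>x. f x \<le> c * g x"
  shows "race_sel \<alpha> m g z e k \<le> ennreal (c powr (2 * \<alpha>)) * race_sel \<alpha> f f z e k"
proof (cases "f (z k) \<le> 0")
  case True
  moreover from True have "m (z k) \<le> 0"
    using f(1)[of "z k"] f(2)[of "z k"] by simp
  ultimately show ?thesis
    by (simp add: race_sel_def race_prob_def)
next
  case False
  define W where "W h = race_total \<alpha> h (\<lambda>i. z (skip k i)) (\<lambda>i. ppr_T e (skip k i))" for h
  have t: "0 < ppr_T e k"
    using e by (rule arrivals_ok_pos)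
  have "race_sel \<alpha> m g z e k = race_prob \<alpha> (m (z k)) (ppr_T e k) (W g)"
    by (simp add: race_sel_def W_def)
  also have "\<dots> \<le> race_prob \<alpha> (c * f (z k)) (ppr_T e k) (ennreal (inverse (c powr \<alpha>)) * W f)"
  proof (rule race_prob_mono)
    have "W f \<le> ennreal (c powr \<alpha>) * W g"
      unfolding W_def using assms by (intro race_total_scaled_mono arrivals_ok_pos) auto
    then have "ennreal (inverse (c powr \<alpha>)) * W f \<le>
        ennreal (inverse (c powr \<alpha>)) * (ennreal (c powr \<alpha>) * W g)"
      by (rule mult_left_mono) simp
    also have "\<dots> = W g"
      using assms by (simp add: mult.assoc[symmetric] ennreal_mult[symmetric])
    finally show "ennreal (inverse (c powr \<alpha>)) * W f \<le> W g" .
  qed (use t assms in auto)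
  also have "\<dots> = inverse (1 + ennreal (inverse (c powr (2 * \<alpha>))) *
      (ennreal ((ppr_T e k / f (z k)) powr \<alpha>) * W f))"
  proof -
    have "(ppr_T e k / (c * f (z k))) powr \<alpha> * inverse (c powr \<alpha>) =
        inverse (c powr (2 * \<alpha>)) * (ppr_T e k / f (z k)) powr \<alpha>"
      using assms False t
      by (simp add: powr_divide powr_mult powr_add[symmetric] divide_simps)
    then have "ennreal ((ppr_T e k / (c * f (z k))) powr \<alpha>) * ennreal (inverse (c powr \<alpha>)) =
        ennreal (inverse (c powr (2 * \<alpha>))) * ennreal ((ppr_T e k / f (z k)) powr \<alpha>)"
      by (simp add: ennreal_mult[symmetric])
    then show ?thesis
      using False assms by (simp add: race_prob_def mult.assoc[symmetric] mult_le_0_iff)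
  qed
  also have "\<dots> \<le> ennreal (c powr (2 * \<alpha>)) * inverse (1 + ennreal ((ppr_T e k / f (z k)) powr \<alpha>) * W f)"
    using assms by (intro inverse_scaled_le) (simp add: ge_one_powr_ge_zero)
  also have "inverse (1 + ennreal ((ppr_T e k / f (z k)) powr \<alpha>) * W f) = race_sel \<alpha> f f z e k"
    using False by (simp add: race_sel_def race_prob_def W_def)
  finally show ?thesis .
qed

section \<open>Densities and the output law of the mechanism\<close>

text \<open>The real-valued derivative that \<open>ppr_weight\<close> uses; for a probability
  measure \<open>P\<close> absolutely continuous with respect to \<open>Q\<close>, the value
  infinity, sent to 0 here, occurs on a \<open>Q\<close>-null set only.\<close>

definition dens :: "'z measure \<Rightarrow> 'z measure \<Rightarrow> 'z \<Rightarrow> real" where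
  "dens Q P x = enn2real (RN_deriv Q P x)"

lemma measurable_dens [measurable]: "dens Q P \<in> borel_measurable Q"
  unfolding dens_def[abs_def] by measurable

lemma dens_nonneg: "0 \<le> dens Q P x"
  by (simp add: dens_def)

lemma nn_integral_dens:
  assumes "prob_space Q" "prob_space P" "sets P = sets Q" "absolutely_continuous Q P"
    and A: "A \<in> sets Q"
  shows "(\<integral>\<^sup>+x. ennreal (dens Q P x) * indicator A x \<partial>Q) = ennreal (measure P A)"
proof -
  interpret Q: prob_space Q by fact
  interpret P: prob_space P by fact
  have "AE x in Q. RN_deriv Q P x \<noteq> \<infinity>"
    using assms by (intro Q.RN_deriv_finite P.sigma_finite_measure_axioms)
  then have "(\<integral>\<^sup>+x. ennreal (dens Q P x) * indicator A x \<partial>Q) =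
      (\<integral>\<^sup>+x. RN_deriv Q P x * indicator A x \<partial>Q)"
    by (intro nn_integral_cong_AE) (auto simp: dens_def less_top elim!: eventually_mono)
  also have "\<dots> = emeasure (density Q (RN_deriv Q P)) A"
    using A by (simp add: emeasure_density)
  also have "\<dots> = ennreal (measure P A)"
    using assms by (simp add: Q.density_RN_deriv P.emeasure_eq_measure)
  finally show ?thesis .
qed

lemma ppr_weight_eq:
  assumes "arrivals_ok e"
  shows "ppr_weight Q P \<alpha> z e k = (dens Q P (z k) / ppr_T e k) powr \<alpha>"
  using arrivals_ok_pos[OF assms, of k] dens_nonneg[of Q P "z k"]
  by (simp add: ppr_weight_def Let_def dens_def[symmetric] powr_minus powr_divide)

text \<open>A finite total makes the real series in \<open>ppr_prob\<close> summable, so its value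
  agrees with the extended one.\<close>

lemma ppr_prob_eq_race_sel:
  assumes e: "arrivals_ok e" and fin: "race_total \<alpha> (dens Q P) z (ppr_T e) \<noteq> \<infinity>"
  shows "ennreal (ppr_prob Q P \<alpha> z e k) = race_sel \<alpha> (dens Q P) (dens Q P) z e k"
proof -
  define a where "a i = (dens Q P (z i) / ppr_T e i) powr \<alpha>" for i
  have a: "0 \<le> a i" for i
    by (simp add: a_def)
  have total: "race_total \<alpha> (dens Q P) z (ppr_T e) = (\<Sum>i. ennreal (a i))"
    by (simp add: race_total_def race_weight_def a_def)
  have summ: "summable a"
    using fin a unfolding total by (intro summable_suminf_not_top) auto
  have "ennreal (a k / (\<Sum>i. a i)) = ennreal (a k) / (\<Sum>i. ennreal (a i))"
  \<comment> \<open>With total 0 every weight is 0, and both quotients are 0 by convention.\<close>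
  proof (cases "(\<Sum>i. a i) = 0")
    case True
    then have "a k = 0"
      using suminf_eq_zero_iff[OF summ a] by simp
    then show ?thesis by simp
  next
    case False
    then have "0 < (\<Sum>i. a i)"
      using suminf_nonneg[OF summ a] by simp
    then show ?thesis
      using a by (simp add: suminf_ennreal2[OF a summ] divide_ennreal)
  qed
  then show ?thesis
    by (simp add: ppr_prob_def ppr_weight_eq[OF e] race_sel_eq_divide[of "dens Q P" z k e, OF dens_nonneg e] total)
      (simp add: a_def race_weight_def)
qed

lemma measurable_ppr_prob [measurable (raw)]:
  assumes [measurable]: "f \<in> measurable N (PiM UNIV (\<lambda>_::nat. Q))"
    "h \<in> measurable N (PiM UNIV (\<lambda>_::nat. exp1))"
  shows "(\<lambda>x. ppr_prob Q P \<alpha> (f x) (h x) k) \<in> borel_measurable N"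
  unfolding ppr_prob_def ppr_weight_def Let_def by measurable

lemma sets_ppr_mech: "sets (ppr_mech Q P \<alpha>) = sets (PiM UNIV (\<lambda>_::nat. Q) \<Otimes>\<^sub>M count_space UNIV)"
  by (simp add: ppr_mech_def)

lemma emeasure_ppr_mech:
  assumes Q: "prob_space Q" and A: "A \<in> sets (ppr_mech Q P \<alpha>)"
  shows "emeasure (ppr_mech Q P \<alpha>) A = (\<integral>\<^sup>+z. \<integral>\<^sup>+e.
      (\<Sum>k. ennreal (ppr_prob Q P \<alpha> z e k) * indicator A (z, k))
      \<partial>PiM UNIV (\<lambda>_::nat. exp1) \<partial>PiM UNIV (\<lambda>_::nat. Q))"
proof -
  interpret E: prob_space exp1 by (rule prob_space_exp1)
  interpret E: sequence_space exp1 ..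
  interpret Q: prob_space Q by fact
  interpret Q: sequence_space Q ..
  interpret K: sigma_finite_measure "count_space (UNIV :: nat set)"
    by (rule sigma_finite_measure_count_space)
  interpret EK: pair_sigma_finite E.S "count_space (UNIV :: nat set)" ..
  have [measurable]: "A \<in> sets (Q.S \<Otimes>\<^sub>M count_space UNIV)"
    using A by (simp add: sets_ppr_mech)
  \<comment> \<open>The index set is countable, so measurability for each fixed \<open>k\<close>
    suffices.\<close>
  have [measurable]: "(\<lambda>(z, e, k). ppr_prob Q P \<alpha> z e k) \<in>
      borel_measurable (Q.S \<Otimes>\<^sub>M E.S \<Otimes>\<^sub>M count_space UNIV)"
    using measurable_compose_countable[of "\<lambda>k (z, e, _). ppr_prob Q P \<alpha> z e k"
        "Q.S \<Otimes>\<^sub>M E.S \<Otimes>\<^sub>M count_space UNIV" borel "\<lambda>(_, _, k). k"]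
    by (simp add: split_beta')
  have "emeasure (ppr_mech Q P \<alpha>) A =
    (\<integral>\<^sup>+(z, k). indicator A (z, k) \<partial>ppr_mech Q P \<alpha>)"
    using A by simp
  also have "\<dots> = (\<integral>\<^sup>+(z, e, k). ennreal (ppr_prob Q P \<alpha> z e k) * indicator A (z, k)
      \<partial>(Q.S \<Otimes>\<^sub>M E.S \<Otimes>\<^sub>M count_space UNIV))"
    unfolding ppr_mech_def
    by (subst nn_integral_distr, measurable, subst nn_integral_density) (simp_all add: split_beta')
  also have "\<dots> = (\<integral>\<^sup>+z. \<integral>\<^sup>+e. \<integral>\<^sup>+k. ennreal (ppr_prob Q P \<alpha> z e k) * indicator A (z, k)
      \<partial>count_space UNIV \<partial>E.S \<partial>Q.S)"
  proof -
    have "(\<integral>\<^sup>+e. \<integral>\<^sup>+k. ennreal (ppr_prob Q P \<alpha> z e k) * indicator A (z, k) \<partial>count_space UNIV \<partial>E.S) =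
      (\<integral>\<^sup>+p. (case p of (e, k) \<Rightarrow> ennreal (ppr_prob Q P \<alpha> z e k) * indicator A (z, k))
        \<partial>(E.S \<Otimes>\<^sub>M count_space UNIV))" if [measurable]: "z \<in> space Q.S" for z
      by (subst K.nn_integral_fst[symmetric]) simp_all
    then show ?thesis
      by (subst EK.P.nn_integral_fst[symmetric]) (simp_all cong: nn_integral_cong)
  qed
  finally show ?thesis
    by (simp add: nn_integral_count_space_nat)
qed

section \<open>Privacy of the compressed mechanism\<close>

text \<open>Minimum and maximum each equal one density on a set and the other off it. The integrals
  therefore differ from 1 by \<open>measure P1 B - c * measure P2 B\<close> and by
  \<open>measure P2 C / c - measure P1 C\<close>, quantities that differential privacy bounds in its
  two directions.\<close>

lemma dp_densities_integral_bounds: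
  assumes Q: "prob_space Q" and P: "prob_space P1" "prob_space P2"
    and S: "sets P1 = sets Q" "sets P2 = sets Q"
    and ac: "absolutely_continuous Q P1" "absolutely_continuous Q P2"
    and c: "1 \<le> c" and \<delta>: "0 \<le> \<delta>"
    and dp: "\<And>A. A \<in> sets Q \<Longrightarrow> measure P1 A \<le> c * measure P2 A + \<delta>"
      "\<And>A. A \<in> sets Q \<Longrightarrow> measure P2 A \<le> c * measure P1 A + \<delta>"
  shows "ennreal (1 - \<delta>) \<le> (\<integral>\<^sup>+x. ennreal (min (dens Q P1 x) (c * dens Q P2 x)) \<partial>Q)"
    and "1 \<le> (\<integral>\<^sup>+x. ennreal (max (dens Q P1 x) (dens Q P2 x / c)) \<partial>Q)"
    and "(\<integral>\<^sup>+x. ennreal (max (dens Q P1 x) (dens Q P2 x / c)) \<partial>Q) \<le> ennreal (1 + \<delta>)"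
proof -
  interpret P1: prob_space P1 by fact
  interpret P2: prob_space P2 by fact
  have sp: "space P1 = space Q"
    using S by (intro sets_eq_imp_space_eq)
  note d1 = nn_integral_dens[OF Q P(1) S(1) ac(1)]
  note d2 = nn_integral_dens[OF Q P(2) S(2) ac(2)]
  have split: "(\<integral>\<^sup>+x. ennreal (if x \<in> A then b * dens Q P2 x else dens Q P1 x) \<partial>Q) =
      ennreal (1 - measure P1 A + b * measure P2 A)" if A: "A \<in> sets Q" and b: "0 \<le> b" for A b
  proof -
    note A[measurable]
    have "(\<integral>\<^sup>+x. ennreal (if x \<in> A then b * dens Q P2 x else dens Q P1 x) \<partial>Q) =
      (\<integral>\<^sup>+x. ennreal (dens Q P1 x) * indicator (space Q - A) x
        + ennreal b * (ennreal (dens Q P2 x) * indicator A x) \<partial>Q)"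
      using b by (intro nn_integral_cong) (auto simp: ennreal_mult dens_nonneg split: split_indicator)
    also have "\<dots> = ennreal (measure P1 (space Q - A)) + ennreal b * ennreal (measure P2 A)"
      by (subst nn_integral_add) (simp_all add: nn_integral_cmult d1 d2)
    also have "measure P1 (space Q - A) = 1 - measure P1 A"
      using P1.prob_compl[of A] A S sp by simp
    finally show ?thesis
      using b by (simp add: ennreal_mult)
  qed
  define B where "B = {x \<in> space Q. c * dens Q P2 x < dens Q P1 x}"
  define C where "C = {x \<in> space Q. dens Q P1 x < inverse c * dens Q P2 x}"
  have B: "B \<in> sets Q" and C: "C \<in> sets Q"
    unfolding B_def C_def by measurable
  have "(\<integral>\<^sup>+x. ennreal (min (dens Q P1 x) (c * dens Q P2 x)) \<partial>Q) =
      ennreal (1 - measure P1 B + c * measure P2 B)"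
    using c by (subst split[OF B, symmetric]) (auto intro!: nn_integral_cong simp: B_def)
  then show "ennreal (1 - \<delta>) \<le> (\<integral>\<^sup>+x. ennreal (min (dens Q P1 x) (c * dens Q P2 x)) \<partial>Q)"
    using dp(1)[OF B] by (simp add: ennreal_leI)
  have "(\<integral>\<^sup>+x. ennreal (max (dens Q P1 x) (dens Q P2 x / c)) \<partial>Q) =
      ennreal (1 - measure P1 C + inverse c * measure P2 C)"
    using c by (subst split[OF C, symmetric]) (auto intro!: nn_integral_cong simp: C_def field_simps)
  moreover have "inverse c * measure P2 C \<le> measure P1 C + \<delta>"
  proof -
    \<comment> \<open>Division by \<open>c\<close> would give \<open>\<delta> / c\<close>;
      \<open>c \<ge> 1\<close> allows the weaker \<open>\<delta>\<close>.\<close>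
    have "measure P2 C \<le> c * measure P1 C + c * \<delta>"
      using dp(2)[OF C] c \<delta> mult_right_mono[of 1 c \<delta>] by simp
    then show ?thesis
      using c by (simp add: field_simps)
  qed
  ultimately show "(\<integral>\<^sup>+x. ennreal (max (dens Q P1 x) (dens Q P2 x / c)) \<partial>Q) \<le> ennreal (1 + \<delta>)"
    by (simp add: ennreal_leI)
  have "1 = (\<integral>\<^sup>+x. ennreal (dens Q P1 x) \<partial>Q)"
    using d1[of "space Q"] P1.prob_space sp by (simp cong: nn_integral_cong)
  also have "\<dots> \<le> (\<integral>\<^sup>+x. ennreal (max (dens Q P1 x) (dens Q P2 x / c)) \<partial>Q)"
    by (intro nn_integral_mono ennreal_leI) simp
  finally show "1 \<le> (\<integral>\<^sup>+x. ennreal (max (dens Q P1 x) (dens Q P2 x / c)) \<partial>Q)" .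
qed

text \<open>Termwise, \<open>race_sel\<close> is at most the scaled second probability if
  \<open>(z, k)\<close> lies in \<open>A\<close>, and at most the first probability otherwise; the
  first probabilities sum to at most 1. The additive form avoids subtraction in
  \<open>ennreal\<close>.\<close>

lemma suminf_ppr_prob_le:
  assumes e: "arrivals_ok e" and \<alpha>: "1 < \<alpha>" and c: "1 \<le> c"
    and fin: "race_total \<alpha> g z (ppr_T e) \<noteq> \<infinity>"
    and m: "\<And>x. m x \<le> dens Q P1 x" "\<And>x. m x \<le> c * dens Q P2 x"
    and g: "\<And>x. dens Q P1 x \<le> g x" "\<And>x. dens Q P2 x \<le> c * g x"
  shows "(\<Sum>k. ennreal (ppr_prob Q P1 \<alpha> z e k) * indicator A (z, k)) + (\<Sum>k. race_sel \<alpha> m g z e k) \<le>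
    ennreal (c powr (2 * \<alpha>)) * (\<Sum>k. ennreal (ppr_prob Q P2 \<alpha> z e k) * indicator A (z, k)) + 1"
proof -
  have fin': "race_total \<alpha> (dens Q P) z (ppr_T e) \<noteq> \<infinity>" if "\<And>x. dens Q P x \<le> c * g x" for P
  proof -
    have "race_total \<alpha> (dens Q P) z (ppr_T e) \<le> ennreal (c powr \<alpha>) * race_total \<alpha> g z (ppr_T e)"
      using c \<alpha> that by (intro race_total_scaled_mono arrivals_ok_pos[OF e] dens_nonneg) auto
    also have "\<dots> < \<infinity>"
      using fin by (simp add: ennreal_mult_less_top less_top)
    finally show ?thesis by simp
  qed
  have "dens Q P1 x \<le> c * g x" for x
    using g(1)[of x] dens_nonneg[of Q P1 x] c mult_right_mono[of 1 c "g x"] by simp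
  note p1 = ppr_prob_eq_race_sel[OF e fin'[OF this]]
    and p2 = ppr_prob_eq_race_sel[OF e fin'[OF g(2)]]
  have le1: "race_sel \<alpha> m g z e k \<le> ennreal (ppr_prob Q P1 \<alpha> z e k)" for k
    unfolding p1 using e \<alpha> m g by (intro race_sel_le_race_sel dens_nonneg) auto
  have le2: "race_sel \<alpha> m g z e k \<le> ennreal (c powr (2 * \<alpha>)) * ennreal (ppr_prob Q P2 \<alpha> z e k)" for k
    unfolding p2 using e \<alpha> c m g by (intro race_sel_le_scaled_race_sel dens_nonneg) auto
  have "(\<Sum>k. ennreal (ppr_prob Q P1 \<alpha> z e k) * indicator A (z, k)) + (\<Sum>k. race_sel \<alpha> m g z e k) =
      (\<Sum>k. ennreal (ppr_prob Q P1 \<alpha> z e k) * indicator A (z, k) + race_sel \<alpha> m g z e k)"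
    by (rule suminf_add) (rule summableI)+
  also have "\<dots> \<le> (\<Sum>k. ennreal (c powr (2 * \<alpha>)) * (ennreal (ppr_prob Q P2 \<alpha> z e k) * indicator A (z, k))
      + ennreal (ppr_prob Q P1 \<alpha> z e k))"
    using le1 le2
    by (intro suminf_le summableI) (auto simp: add.commute intro: add_mono split: split_indicator)
  also have "\<dots> = (\<Sum>k. ennreal (c powr (2 * \<alpha>)) * (ennreal (ppr_prob Q P2 \<alpha> z e k) * indicator A (z, k)))
      + (\<Sum>k. ennreal (ppr_prob Q P1 \<alpha> z e k))"
    by (rule suminf_add[symmetric]) (rule summableI)+
  also have "\<dots> \<le> ennreal (c powr (2 * \<alpha>)) * (\<Sum>k. ennreal (ppr_prob Q P2 \<alpha> z e k) * indicator A (z, k)) + 1"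
    unfolding ennreal_suminf_cmult p1
    by (intro add_left_mono suminf_race_sel_le_1 dens_nonneg e)
  finally show ?thesis .
qed

text \<open>Finiteness makes \<open>measure\<close> faithful, as an infinite \<open>emeasure\<close>
  would be read as 0.\<close>

lemma emeasure_ppr_mech_le_1:
  assumes Q: "prob_space Q" and P: "prob_space P" "sets P = sets Q" "absolutely_continuous Q P"
    and \<alpha>: "1 < \<alpha>" and A: "A \<in> sets (ppr_mech Q P \<alpha>)"
  shows "emeasure (ppr_mech Q P \<alpha>) A \<le> 1"
proof -
  interpret E: prob_space exp1 by (rule prob_space_exp1)
  interpret E: sequence_space exp1 ..
  interpret Q: prob_space Q by fact
  interpret Q: sequence_space Q ..
  have "(\<integral>\<^sup>+x. ennreal (dens Q P x) \<partial>Q) = ennreal (measure P (space Q))"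
    using nn_integral_dens[OF Q P, of "space Q"] by (simp cong: nn_integral_cong)
  then have fin: "(\<integral>\<^sup>+x. ennreal (dens Q P x) \<partial>Q) < \<infinity>"
    by simp
  have "emeasure (ppr_mech Q P \<alpha>) A \<le> (\<integral>\<^sup>+z. \<integral>\<^sup>+e. 1 \<partial>E.S \<partial>Q.S)"
    unfolding emeasure_ppr_mech[OF Q A]
  proof (rule nn_integral_mono_AE)
    show "AE z in Q.S. (\<integral>\<^sup>+e. (\<Sum>k. ennreal (ppr_prob Q P \<alpha> z e k) * indicator A (z, k)) \<partial>E.S)
        \<le> (\<integral>\<^sup>+e. 1 \<partial>E.S)"
      using AE_race_total_finite[OF Q \<alpha> measurable_dens dens_nonneg fin]
    proof eventually_elim
      case (elim z)
      show ?case
      proof (rule nn_integral_mono_AE)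
        show "AE e in E.S. (\<Sum>k. ennreal (ppr_prob Q P \<alpha> z e k) * indicator A (z, k)) \<le> 1"
          using elim AE_arrivals_ok
        proof eventually_elim
          case (elim e)
          have "(\<Sum>k. ennreal (ppr_prob Q P \<alpha> z e k) * indicator A (z, k)) \<le>
              (\<Sum>k. race_sel \<alpha> (dens Q P) (dens Q P) z e k)"
            unfolding ppr_prob_eq_race_sel[OF elim(2,1)]
            by (intro suminf_le summableI) (simp split: split_indicator)
          also have "\<dots> \<le> 1"
            by (intro suminf_race_sel_le_1 dens_nonneg elim)
          finally show ?case .
        qed
      qed
    qed
  qed
  then show ?thesis
    by (simp add: E.P.emeasure_space_1 Q.P.emeasure_space_1)
qed

text \<open>Integrating the pointwise inequality gives
  \<open>I P1 + X \<le> c powr (2 * \<alpha>) * I P2 + 1\<close>, so \<open>1 - X\<close> is the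
  additive loss. The integrals of \<open>m\<close> and \<open>g\<close> give
  \<open>X * (1 + \<delta>) \<ge> 1 - \<delta>\<close>, hence a loss of at most
  \<open>2 * \<delta>\<close>.\<close>

lemma ppr_mech_dp:
  assumes Q: "prob_space Q" and P: "prob_space P1" "prob_space P2"
    and S: "sets P1 = sets Q" "sets P2 = sets Q"
    and ac: "absolutely_continuous Q P1" "absolutely_continuous Q P2"
    and \<alpha>: "1 < \<alpha>" and c: "1 \<le> c" and \<delta>: "0 \<le> \<delta>"
    and dp: "\<And>A. A \<in> sets Q \<Longrightarrow> measure P1 A \<le> c * measure P2 A + \<delta>"
      "\<And>A. A \<in> sets Q \<Longrightarrow> measure P2 A \<le> c * measure P1 A + \<delta>"
    and A: "A \<in> sets (ppr_mech Q P1 \<alpha>)"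
  shows "measure (ppr_mech Q P1 \<alpha>) A \<le> c powr (2 * \<alpha>) * measure (ppr_mech Q P2 \<alpha>) A + 2 * \<delta>"
proof -
  interpret E: prob_space exp1 by (rule prob_space_exp1)
  interpret E: sequence_space exp1 ..
  interpret Q: prob_space Q by fact
  interpret Q: sequence_space Q ..
  \<comment> \<open>The largest \<open>m\<close> and the smallest \<open>g\<close> that meet the
    constraints of \<open>suminf_ppr_prob_le\<close>, which makes \<open>X\<close> as large as
    possible.\<close>
  define m where "m x = min (dens Q P1 x) (c * dens Q P2 x)" for x
  define g where "g x = max (dens Q P1 x) (dens Q P2 x / c)" for x
  have m_meas [measurable]: "m \<in> borel_measurable Q" and g_meas [measurable]: "g \<in> borel_measurable Q"
    unfolding m_def[abs_def] g_def[abs_def] by measurable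
  have [measurable]: "A \<in> sets (Q.S \<Otimes>\<^sub>M count_space UNIV)"
    using A by (simp add: sets_ppr_mech)
  have g_nonneg: "0 \<le> g x" for x
    by (simp add: g_def dens_nonneg le_max_iff_disj)
  have bounds: "ennreal (1 - \<delta>) \<le> (\<integral>\<^sup>+x. ennreal (m x) \<partial>Q)"
      "1 \<le> (\<integral>\<^sup>+x. ennreal (g x) \<partial>Q)" "(\<integral>\<^sup>+x. ennreal (g x) \<partial>Q) \<le> ennreal (1 + \<delta>)"
    unfolding m_def g_def
    by (rule dp_densities_integral_bounds[OF Q P S ac c \<delta>]; fact dp)+
  have g_fin: "(\<integral>\<^sup>+x. ennreal (g x) \<partial>Q) < \<infinity>"
    using le_less_trans[OF bounds(3) ennreal_less_top] by simp
  have g_pos: "(\<integral>\<^sup>+x. ennreal (g x) \<partial>Q) \<noteq> 0"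
    using bounds(2) by auto
  define X where "X = (\<integral>\<^sup>+z. \<integral>\<^sup>+e. (\<Sum>k. race_sel \<alpha> m g z e k) \<partial>E.S \<partial>Q.S)"
  define I where "I P = (\<integral>\<^sup>+z. \<integral>\<^sup>+e. (\<Sum>k. ennreal (ppr_prob Q P \<alpha> z e k) * indicator A (z, k)) \<partial>E.S \<partial>Q.S)" for P
  have I: "emeasure (ppr_mech Q P \<alpha>) A = I P" for P
    unfolding I_def using A by (intro emeasure_ppr_mech Q) (simp add: sets_ppr_mech)

  have "I P1 + X = (\<integral>\<^sup>+z. \<integral>\<^sup>+e. (\<Sum>k. ennreal (ppr_prob Q P1 \<alpha> z e k) * indicator A (z, k))
      + (\<Sum>k. race_sel \<alpha> m g z e k) \<partial>E.S \<partial>Q.S)"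
  proof -
    have "(\<integral>\<^sup>+e. (\<Sum>k. ennreal (ppr_prob Q P1 \<alpha> z e k) * indicator A (z, k)) \<partial>E.S)
        + (\<integral>\<^sup>+e. (\<Sum>k. race_sel \<alpha> m g z e k) \<partial>E.S) =
      (\<integral>\<^sup>+e. (\<Sum>k. ennreal (ppr_prob Q P1 \<alpha> z e k) * indicator A (z, k))
        + (\<Sum>k. race_sel \<alpha> m g z e k) \<partial>E.S)" if [measurable]: "z \<in> space Q.S" for z
      by (rule nn_integral_add[symmetric]) measurable
    note sum = this
    have "I P1 + X = (\<integral>\<^sup>+z. (\<integral>\<^sup>+e. (\<Sum>k. ennreal (ppr_prob Q P1 \<alpha> z e k) * indicator A (z, k)) \<partial>E.S)
        + (\<integral>\<^sup>+e. (\<Sum>k. race_sel \<alpha> m g z e k) \<partial>E.S) \<partial>Q.S)"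
      unfolding I_def X_def by (rule nn_integral_add[symmetric]) measurable
    also have "\<dots> = (\<integral>\<^sup>+z. \<integral>\<^sup>+e. (\<Sum>k. ennreal (ppr_prob Q P1 \<alpha> z e k) * indicator A (z, k))
        + (\<Sum>k. race_sel \<alpha> m g z e k) \<partial>E.S \<partial>Q.S)"
      using sum by (rule nn_integral_cong)
    finally show ?thesis .
  qed
  also have "\<dots> \<le> (\<integral>\<^sup>+z. \<integral>\<^sup>+e. ennreal (c powr (2 * \<alpha>)) *
      (\<Sum>k. ennreal (ppr_prob Q P2 \<alpha> z e k) * indicator A (z, k)) + 1 \<partial>E.S \<partial>Q.S)"
  proof (rule nn_integral_mono_AE)
    show "AE z in Q.S. (\<integral>\<^sup>+e. (\<Sum>k. ennreal (ppr_prob Q P1 \<alpha> z e k) * indicator A (z, k))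
        + (\<Sum>k. race_sel \<alpha> m g z e k) \<partial>E.S) \<le> (\<integral>\<^sup>+e. ennreal (c powr (2 * \<alpha>)) *
        (\<Sum>k. ennreal (ppr_prob Q P2 \<alpha> z e k) * indicator A (z, k)) + 1 \<partial>E.S)"
      using AE_race_total_finite[OF Q \<alpha> g_meas g_nonneg g_fin]
    proof eventually_elim
      case (elim z)
      show ?case
      proof (rule nn_integral_mono_AE)
        show "AE e in E.S. (\<Sum>k. ennreal (ppr_prob Q P1 \<alpha> z e k) * indicator A (z, k))
          + (\<Sum>k. race_sel \<alpha> m g z e k) \<le> ennreal (c powr (2 * \<alpha>)) *
          (\<Sum>k. ennreal (ppr_prob Q P2 \<alpha> z e k) * indicator A (z, k)) + 1"
          using elim AE_arrivals_ok
        proof eventually_elim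
          case (elim e)
          have g2: "dens Q P2 x \<le> c * g x" for x
          proof -
            have "dens Q P2 x = c * (dens Q P2 x / c)"
              using c by simp
            also have "\<dots> \<le> c * g x"
              using c by (intro mult_left_mono) (simp_all add: g_def)
            finally show ?thesis .
          qed
          show ?case
            by (rule suminf_ppr_prob_le[OF elim(2) \<alpha> c elim(1)]) (use g2 in \<open>simp_all add: m_def g_def\<close>)
        qed
      qed
    qed
  qed
  also have "\<dots> = ennreal (c powr (2 * \<alpha>)) * I P2 + 1"
  proof -
    have "(\<integral>\<^sup>+e. ennreal (c powr (2 * \<alpha>)) *
        (\<Sum>k. ennreal (ppr_prob Q P2 \<alpha> z e k) * indicator A (z, k)) + 1 \<partial>E.S) =
        ennreal (c powr (2 * \<alpha>)) *
        (\<integral>\<^sup>+e. (\<Sum>k. ennreal (ppr_prob Q P2 \<alpha> z e k) * indicator A (z, k)) \<partial>E.S) + 1"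
      if [measurable]: "z \<in> space Q.S" for z
      by (subst nn_integral_add, measurable, subst nn_integral_cmult)
        (simp_all add: E.P.emeasure_space_1)
    then have "(\<integral>\<^sup>+z. \<integral>\<^sup>+e. ennreal (c powr (2 * \<alpha>)) *
        (\<Sum>k. ennreal (ppr_prob Q P2 \<alpha> z e k) * indicator A (z, k)) + 1 \<partial>E.S \<partial>Q.S) =
      (\<integral>\<^sup>+z. ennreal (c powr (2 * \<alpha>)) *
        (\<integral>\<^sup>+e. (\<Sum>k. ennreal (ppr_prob Q P2 \<alpha> z e k) * indicator A (z, k)) \<partial>E.S) + 1 \<partial>Q.S)"
      by (rule nn_integral_cong)
    also have "\<dots> = ennreal (c powr (2 * \<alpha>)) * I P2 + 1"
      unfolding I_def
      by (subst nn_integral_add, measurable, subst nn_integral_cmult)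
        (simp_all add: Q.P.emeasure_space_1)
    finally show ?thesis .
  qed
  finally have main: "I P1 + X \<le> ennreal (c powr (2 * \<alpha>)) * I P2 + 1" .

  have "X * (\<integral>\<^sup>+x. ennreal (g x) \<partial>Q) = (\<integral>\<^sup>+x. ennreal (m x) \<partial>Q)"
    unfolding X_def using nn_integral_suminf_race_sel_eq[OF Q \<alpha> m_meas g_meas g_nonneg g_pos g_fin] by simp
  then have X_lower: "ennreal (1 - \<delta>) \<le> X * ennreal (1 + \<delta>)"
    using bounds(1) mult_left_mono[OF bounds(3), of X] by simp
  define d where "d = c powr (2 * \<alpha>)"
  have "I P2 \<le> 1"
    unfolding I[symmetric] using A by (intro emeasure_ppr_mech_le_1 Q P S ac \<alpha>) (simp add: sets_ppr_mech)
  then have fin2: "I P2 < \<top>"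
    by (rule le_less_trans) simp
  \<comment> \<open>All three quantities are finite, so the rest is real arithmetic.\<close>
  then have "I P1 + X < \<top>"
    by (intro le_less_trans[OF main]) (simp add: ennreal_mult_less_top)
  with fin2 obtain i1 i2 x where real: "I P1 = ennreal i1" "I P2 = ennreal i2" "X = ennreal x"
      "0 \<le> i1" "0 \<le> i2" "0 \<le> x"
    by (cases "I P1"; cases "I P2"; cases X) auto
  have "ennreal (i1 + x) \<le> ennreal (d * i2 + 1)"
    using main real by (simp add: d_def ennreal_mult)
  then have "i1 + x \<le> d * i2 + 1"
    using real by (subst (asm) ennreal_le_iff) (auto simp: d_def)
  \<comment> \<open>\<open>(1 - 2 * \<delta>) * (1 + \<delta>)\<close> equals
    \<open>1 - \<delta>\<close> minus twice the square of \<open>\<delta>\<close>.\<close>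
  moreover have "1 - 2 * \<delta> \<le> x"
  proof (rule ccontr)
    assume "\<not> 1 - 2 * \<delta> \<le> x"
    then have "x * (1 + \<delta>) < (1 - 2 * \<delta>) * (1 + \<delta>)"
      using \<delta> by (intro mult_strict_right_mono) auto
    also have "\<dots> \<le> 1 - \<delta>"
      using \<delta> by (simp add: algebra_simps)
    finally have "x * (1 + \<delta>) < 1 - \<delta>" .
    moreover have "1 - \<delta> \<le> x * (1 + \<delta>)"
      using X_lower real \<delta> by (simp add: ennreal_mult[symmetric] del: ennreal_plus)
    ultimately show False by simp
  qed
  moreover have "measure (ppr_mech Q P1 \<alpha>) A = i1" "measure (ppr_mech Q P2 \<alpha>) A = i2"
    using real by (simp_all add: measure_def I)
  ultimately show ?thesis
    by (simp add: d_def)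
qed

theorem theorem3:
  fixes N :: "('x \<times> 'x) set" and Q :: "'z measure" and P :: "'x \<Rightarrow> 'z measure"
    and \<epsilon> \<delta> \<alpha> :: real
  assumes "sym N"
    and "prob_space Q"
    and "\<And>x. prob_space (P x)"
    and "\<And>x. sets (P x) = sets Q"
    and "\<And>x. absolutely_continuous Q (P x)"
    and "\<epsilon> \<ge> 0"
    and "dp_kernel N P \<epsilon> \<delta>"
    and "\<alpha> > 1"
  shows "dp_kernel N (\<lambda>x. ppr_mech Q (P x) \<alpha>) (2 * \<alpha> * \<epsilon>) (2 * \<delta>)"
  unfolding dp_kernel_def
proof safe
  fix x x' A
  assume N: "(x, x') \<in> N" and A: "A \<in> sets (ppr_mech Q (P x) \<alpha>)"
  have dp: "measure (P y) B \<le> exp \<epsilon> * measure (P y') B + \<delta>"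
    if "(y, y') \<in> N" "B \<in> sets Q" for y y' B
    using assms(4,7) that unfolding dp_kernel_def by blast
  have "(x', x) \<in> N"
    using assms(1) N by (rule symD)
  \<comment> \<open>The empty set in the privacy inequality gives the sign of
    \<open>\<delta>\<close>.\<close>
  moreover have "0 \<le> \<delta>"
    using dp[OF N, of "{}"] by simp
  \<comment> \<open>Here \<open>c = exp \<epsilon>\<close>, at least 1 as
    \<open>\<epsilon> \<ge> 0\<close>; symmetry of \<open>N\<close> supplies the reverse
    inequality.\<close>
  ultimately have "measure (ppr_mech Q (P x) \<alpha>) A \<le>
      exp \<epsilon> powr (2 * \<alpha>) * measure (ppr_mech Q (P x') \<alpha>) A + 2 * \<delta>"
    using N A assms(6,8)
    by (intro ppr_mech_dp[OF assms(2,3,3,4,4,5,5)] dp) simp_all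
  then show "measure (ppr_mech Q (P x) \<alpha>) A \<le>
      exp (2 * \<alpha> * \<epsilon>) * measure (ppr_mech Q (P x') \<alpha>) A + 2 * \<delta>"
    by (simp add: exp_powr_real mult.commute)
qed

end
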